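(* For any smooth spacetime $M$ there are bijections $$\mathrm{IP}(M)\cong\mathrm{IP}(M_{\neg\neg})\qquad\text{and}\qquad\mathrm{IF}(M)\cong\mathrm{IF}(M_{\neg\neg}).$$
   Context: A smooth spacetime is a connected Lorentzian manifold $(M,g)$ of dimension $\geq2$ (signature $(-+\cdots+)$) with a time orientation. A nonzero tangent vector $v$ is causal if $g(v,v)\leq0$ and timelike if $g(v,v)<0$; causal (timelike) curves are piecewise $C^1$ curves whose tangent vectors are all future directed and causal (timelike). $x\preccurlyeq y$ means $x=y$ or there is a causal curve from $x$ to $y$; $x\ll y$ means there is a timelike curve from $x$ to $y$. $J^{+}(A)=\{y:\exists x\in A,\ x\preccurlyeq y\}$, $J^-(A)=\{y:\exists x\in A,\ y\preccurlyeq x\}$, and $I^\pm(A)$ likewise with $\ll$. $\mathrm{IP}(M)$: subsets $\varnothing\neq P=I^-(P)\subseteq M$ such that $P=I^-(A)\cup I^-(B)$ implies $P=I^-(A)$ or $P=I^-(B)$. $\mathrm{IF}(M)$: dually with $I^+$. Ordered locale: a frame $\mathcal{O}X$ (order $\sqsubseteq$, bottom $\varnothing$) with a preorder $\trianglelefteq$ on it such that $U_i\trianglelefteq V_i$ for all $i$ implies $\bigvee U_i\trianglelefteq\bigvee V_i$. Cones: $\Uparrow U=\bigvee\{V:U\trianglelefteq V\}$, $\Downarrow U=\bigvee\{W:W\trianglelefteq U\}$. $\mathrm{IP}(X)$ is the set of $P\in\mathcal{O}X$ with $\varnothing\neq P=\Downarrow P$ such that $P=\Downarrow U\vee\Downarrow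 V$ implies $P=\Downarrow U$ or $P=\Downarrow V$; $\mathrm{IF}(X)$ is defined dually using $\Uparrow$. $M$ is an ordered locale with frame $\mathcal{O}M$ of open sets and $U\trianglelefteq V$ iff $U\subseteq J^-(V)$ and $V\subseteq J^+(U)$. $M_{\neg\neg}$ is the double-negation sublocale: its frame consists of the regular open sets $U=\neg\neg U$ (where $\neg\neg U=(\overline{U})^\circ$), ordered by inclusion (joins are $\neg\neg$ of unions). It is an ordered locale with the preorder $\trianglelefteq_i$ induced by the sublocale inclusion $i$, $i^{-1}(V)=\neg\neg V$: for regular opens $U,U'$, $U\trianglelefteq_iU'$ iff (for every $V\in\mathcal{O}M$ with $U\subseteq\neg\neg V$ there is $V'\in\mathcal{O}M$ with $V\trianglelefteq V'$ and $U'\subseteq\neg\neg V'$) and (for every $V'\in\mathcal{O}M$ with $U'\subseteq\neg\neg V'$ there is $V\in\mathcal{O}M$ with $V\trianglelefteq V'$ and $U\subseteq\neg\neg V$). $\mathrm{IP}(M_{\neg\neg})$ and $\mathrm{IF}(M_{\neg\neg})$ are taken in this ordered locale. *)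

theory Defs
  imports "HOL-Analysis.Analysis" "HOL-Algebra.Complete_Lattice"
begin

section \<open>Smooth manifolds\<close>

text \<open>For open \<open>S\<close> in a Euclidean space, \<open>Ck_on k S f\<close> says that \<open>f\<close> is \<open>k\<close> times continuously
  differentiable on \<open>S\<close>: all iterated directional derivatives up to order \<open>k\<close> exist and are continuous.\<close>

fun Ck_on :: "nat \<Rightarrow> 'e::euclidean_space set \<Rightarrow> ('e \<Rightarrow> 'f::real_normed_vector) \<Rightarrow> bool" where
  "Ck_on 0 S f \<longleftrightarrow> continuous_on S f"
| "Ck_on (Suc k) S f \<longleftrightarrow> (\<forall>x\<in>S. f differentiable (at x)) \<and>
     (\<forall>v. Ck_on k S (\<lambda>x. frechet_derivative f (at x) v))"

definition smooth_on :: "'e::euclidean_space set \<Rightarrow> ('e \<Rightarrow> 'f::real_normed_vector) \<Rightarrow> bool" where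
  "smooth_on S f \<longleftrightarrow> (\<forall>k. Ck_on k S f)"

text \<open>A chart is a pair of a domain and a coordinate map, whose values outside the domain are
  irrelevant. The model space \<open>'e\<close> is an arbitrary Euclidean space, of dimension \<open>DIM('e)\<close>.\<close>

type_synonym ('a, 'e) chart = "'a set \<times> ('a \<Rightarrow> 'e)"

definition is_chart :: "'a topology \<Rightarrow> ('a, 'e::euclidean_space) chart \<Rightarrow> bool" where
  "is_chart X c \<longleftrightarrow> openin X (fst c) \<and> open (snd c ` fst c) \<and>
     homeomorphic_map (subtopology X (fst c)) (top_of_set (snd c ` fst c)) (snd c)"

definition coord_inv :: "('a, 'e) chart \<Rightarrow> 'e \<Rightarrow> 'a" where
  "coord_inv c = inv_into (fst c) (snd c)"

definition transition :: "('a, 'e) chart \<Rightarrow> ('a, 'e) chart \<Rightarrow> 'e \<Rightarrow> 'e" where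
  "transition c d = snd d \<circ> coord_inv c"

definition smooth_atlas :: "'a topology \<Rightarrow> ('a, 'e::euclidean_space) chart set \<Rightarrow> bool" where
  "smooth_atlas X \<A> \<longleftrightarrow> (\<forall>c\<in>\<A>. is_chart X c) \<and> \<Union> (fst ` \<A>) = topspace X \<and>
     (\<forall>c\<in>\<A>. \<forall>d\<in>\<A>. smooth_on (snd c ` (fst c \<inter> fst d)) (transition c d))"

definition smooth_manifold :: "'a topology \<Rightarrow> ('a, 'e::euclidean_space) chart set \<Rightarrow> bool" where
  "smooth_manifold X \<A> \<longleftrightarrow> Hausdorff_space X \<and> second_countable X \<and> smooth_atlas X \<A>"

text \<open>A tangent vector at \<open>p\<close> is a family of coordinate vectors, one for each chart around \<open>p\<close>,
  related by the derivatives of the transition maps. Components at all other charts are set to \<open>0\<close>,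
  so that a tangent vector is determined by its component in any one chart around \<open>p\<close>.\<close>

type_synonym ('a, 'e) tvec = "('a, 'e) chart \<Rightarrow> 'e"

definition charts_at :: "('a, 'e) chart set \<Rightarrow> 'a \<Rightarrow> ('a, 'e) chart set" where
  "charts_at \<A> p = {c \<in> \<A>. p \<in> fst c}"

definition tangent_space ::
    "('a, 'e::euclidean_space) chart set \<Rightarrow> 'a \<Rightarrow> ('a, 'e) tvec set" where
  "tangent_space \<A> p = {v. (\<forall>c. c \<notin> charts_at \<A> p \<longrightarrow> v c = 0) \<and>
     (\<forall>c\<in>charts_at \<A> p. \<forall>d\<in>charts_at \<A> p.
        v d = frechet_derivative (transition c d) (at (snd c p)) (v c))}"

text \<open>The tangent vector at \<open>p\<close> with component \<open>a\<close> in the chart \<open>c\<close> around \<open>p\<close>. The map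
  \<open>coord_vec \<A> c p\<close> is the linear isomorphism from \<open>'e\<close> to the tangent space at \<open>p\<close> given by \<open>c\<close>.\<close>

definition coord_vec ::
    "('a, 'e::euclidean_space) chart set \<Rightarrow> ('a, 'e) chart \<Rightarrow> 'a \<Rightarrow> 'e \<Rightarrow> ('a, 'e) tvec" where
  "coord_vec \<A> c p a =
     (\<lambda>d. if d \<in> charts_at \<A> p then frechet_derivative (transition c d) (at (snd c p)) a else 0)"


section \<open>Smooth spacetimes\<close>

text \<open>A symmetric bilinear form of signature \<open>(-+\<dots>+)\<close>: there is a frame \<open>E\<close> in which its matrix
  is \<open>diag(-1,1,\<dots>,1)\<close>.\<close>

definition lorentz_form :: "('e::euclidean_space \<Rightarrow> 'e \<Rightarrow> real) \<Rightarrow> bool" where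
  "lorentz_form B \<longleftrightarrow> bilinear B \<and> (\<forall>v w. B v w = B w v) \<and>
     (\<exists>E :: 'e \<Rightarrow> 'e. linear E \<and> bij E \<and> (\<exists>t\<in>Basis. \<forall>i\<in>Basis. \<forall>j\<in>Basis.
        B (E i) (E j) = (if i \<noteq> j then 0 else if i = t then -1 else 1)))"

text \<open>The field \<open>orient\<close> is a continuous timelike vector field, and the time orientation it
  represents makes the timecone containing it the future one, see \<open>future_causal\<close> below.\<close>

record ('a, 'e) spacetime =
  pts :: "'a topology"
  atlas :: "('a, 'e) chart set"
  metric :: "'a \<Rightarrow> ('a, 'e) tvec \<Rightarrow> ('a, 'e) tvec \<Rightarrow> real"
  orient :: "'a \<Rightarrow> ('a, 'e) tvec"

definition metric_coord :: "('a, 'e::euclidean_space) spacetime \<Rightarrow> ('a, 'e) chart \<Rightarrow> 'a \<Rightarrow> 'e \<Rightarrow> 'e \<Rightarrow> real"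
  where "metric_coord M c p a b =
    metric M p (coord_vec (atlas M) c p a) (coord_vec (atlas M) c p b)"

definition lorentzian_metric :: "('a, 'e::euclidean_space) spacetime \<Rightarrow> bool" where
  "lorentzian_metric M \<longleftrightarrow> (\<forall>c\<in>atlas M.
     (\<forall>p\<in>fst c. lorentz_form (metric_coord M c p)) \<and>
     (\<forall>a b. smooth_on (snd c ` fst c) (\<lambda>x. metric_coord M c (coord_inv c x) a b)))"

definition causal_vector :: "('a, 'e::euclidean_space) spacetime \<Rightarrow> 'a \<Rightarrow> ('a, 'e) tvec \<Rightarrow> bool" where
  "causal_vector M p v \<longleftrightarrow> v \<in> tangent_space (atlas M) p \<and> v \<noteq> (\<lambda>_. 0) \<and> metric M p v v \<le> 0"

definition timelike_vector :: "('a, 'e::euclidean_space) spacetime \<Rightarrow> 'a \<Rightarrow> ('a, 'e) tvec \<Rightarrow> bool" where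
  "timelike_vector M p v \<longleftrightarrow> v \<in> tangent_space (atlas M) p \<and> v \<noteq> (\<lambda>_. 0) \<and> metric M p v v < 0"

definition time_orientation :: "('a, 'e::euclidean_space) spacetime \<Rightarrow> bool" where
  "time_orientation M \<longleftrightarrow> (\<forall>p\<in>topspace (pts M). timelike_vector M p (orient M p)) \<and>
     (\<forall>c\<in>atlas M. continuous_map (subtopology (pts M) (fst c)) euclidean (\<lambda>p. orient M p c))"

definition smooth_spacetime :: "('a, 'e::euclidean_space) spacetime \<Rightarrow> bool" where
  "smooth_spacetime M \<longleftrightarrow> smooth_manifold (pts M) (atlas M) \<and> connected_space (pts M) \<and>
     DIM('e) \<ge> 2 \<and> lorentzian_metric M \<and> time_orientation M"

definition future_causal :: "('a, 'e::euclidean_space) spacetime \<Rightarrow> 'a \<Rightarrow> ('a, 'e) tvec \<Rightarrow> bool" where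
  "future_causal M p v \<longleftrightarrow> causal_vector M p v \<and> metric M p v (orient M p) < 0"

definition future_timelike :: "('a, 'e::euclidean_space) spacetime \<Rightarrow> 'a \<Rightarrow> ('a, 'e) tvec \<Rightarrow> bool" where
  "future_timelike M p v \<longleftrightarrow> timelike_vector M p v \<and> metric M p v (orient M p) < 0"


section \<open>The causality and chronology relations\<close>

text \<open>Derivatives are taken within the closed parameter interval, so they are one-sided at its
  endpoints. In particular a piecewise \<open>C\<^sup>1\<close> curve has two tangent vectors at a breakpoint, and the
  library's \<open>piecewise_C1_differentiable_on\<close>, which ignores breakpoints, is not used here.\<close>

definition velocity ::
    "('a, 'e::euclidean_space) chart set \<Rightarrow> (real \<Rightarrow> 'a) \<Rightarrow> real \<Rightarrow> real \<Rightarrow> real \<Rightarrow> ('a, 'e) tvec" where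
  "velocity \<A> \<gamma> a b t = (\<lambda>c. if c \<in> charts_at \<A> (\<gamma> t)
     then vector_derivative (snd c \<circ> \<gamma>) (at t within {a..b}) else 0)"

definition C1_curve ::
    "('a, 'e::euclidean_space) spacetime \<Rightarrow> (real \<Rightarrow> 'a) \<Rightarrow> real \<Rightarrow> real \<Rightarrow> bool" where
  "C1_curve M \<gamma> a b \<longleftrightarrow> a < b \<and> continuous_map (top_of_set {a..b}) (pts M) \<gamma> \<and>
     (\<forall>c\<in>atlas M.
        (\<forall>t\<in>{t\<in>{a..b}. \<gamma> t \<in> fst c}. (snd c \<circ> \<gamma>) differentiable (at t within {a..b})) \<and>
        continuous_on {t\<in>{a..b}. \<gamma> t \<in> fst c} (\<lambda>t. velocity (atlas M) \<gamma> a b t c))"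

definition piecewise_C1_curve ::
    "('a, 'e::euclidean_space) spacetime \<Rightarrow> ('a \<Rightarrow> ('a, 'e) tvec \<Rightarrow> bool) \<Rightarrow>
      (real \<Rightarrow> 'a) \<Rightarrow> real \<Rightarrow> real \<Rightarrow> bool" where
  "piecewise_C1_curve M Q \<gamma> a b \<longleftrightarrow> (\<exists>(n::nat) s. 0 < n \<and> s 0 = a \<and> s n = b \<and>
     (\<forall>i<n. C1_curve M \<gamma> (s i) (s (Suc i)) \<and>
        (\<forall>t\<in>{s i..s (Suc i)}. Q (\<gamma> t) (velocity (atlas M) \<gamma> (s i) (s (Suc i)) t))))"

definition causal_curve ::
    "('a, 'e::euclidean_space) spacetime \<Rightarrow> (real \<Rightarrow> 'a) \<Rightarrow> real \<Rightarrow> real \<Rightarrow> bool" where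
  "causal_curve M = piecewise_C1_curve M (future_causal M)"

definition timelike_curve ::
    "('a, 'e::euclidean_space) spacetime \<Rightarrow> (real \<Rightarrow> 'a) \<Rightarrow> real \<Rightarrow> real \<Rightarrow> bool" where
  "timelike_curve M = piecewise_C1_curve M (future_timelike M)"

definition causal_le :: "('a, 'e::euclidean_space) spacetime \<Rightarrow> 'a \<Rightarrow> 'a \<Rightarrow> bool" where
  "causal_le M x y \<longleftrightarrow> (x \<in> topspace (pts M) \<and> x = y) \<or>
     (\<exists>\<gamma> a b. causal_curve M \<gamma> a b \<and> \<gamma> a = x \<and> \<gamma> b = y)"

definition chron_less :: "('a, 'e::euclidean_space) spacetime \<Rightarrow> 'a \<Rightarrow> 'a \<Rightarrow> bool" where
  "chron_less M x y \<longleftrightarrow> (\<exists>\<gamma> a b. timelike_curve M \<gamma> a b \<and> \<gamma> a = x \<and> \<gamma> b = y)"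

definition J_plus :: "('a, 'e::euclidean_space) spacetime \<Rightarrow> 'a set \<Rightarrow> 'a set" where
  "J_plus M A = {y. \<exists>x\<in>A. causal_le M x y}"

definition J_minus :: "('a, 'e::euclidean_space) spacetime \<Rightarrow> 'a set \<Rightarrow> 'a set" where
  "J_minus M A = {y. \<exists>x\<in>A. causal_le M y x}"

definition I_plus :: "('a, 'e::euclidean_space) spacetime \<Rightarrow> 'a set \<Rightarrow> 'a set" where
  "I_plus M A = {y. \<exists>x\<in>A. chron_less M x y}"

definition I_minus :: "('a, 'e::euclidean_space) spacetime \<Rightarrow> 'a set \<Rightarrow> 'a set" where
  "I_minus M A = {y. \<exists>x\<in>A. chron_less M y x}"

definition spacetime_IP :: "('a, 'e::euclidean_space) spacetime \<Rightarrow> 'a set set" where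
  "spacetime_IP M = {P. P \<subseteq> topspace (pts M) \<and> P \<noteq> {} \<and> P = I_minus M P \<and>
     (\<forall>A B. A \<subseteq> topspace (pts M) \<longrightarrow> B \<subseteq> topspace (pts M) \<longrightarrow>
        P = I_minus M A \<union> I_minus M B \<longrightarrow> P = I_minus M A \<or> P = I_minus M B)}"

definition spacetime_IF :: "('a, 'e::euclidean_space) spacetime \<Rightarrow> 'a set set" where
  "spacetime_IF M = {P. P \<subseteq> topspace (pts M) \<and> P \<noteq> {} \<and> P = I_plus M P \<and>
     (\<forall>A B. A \<subseteq> topspace (pts M) \<longrightarrow> B \<subseteq> topspace (pts M) \<longrightarrow>
        P = I_plus M A \<union> I_plus M B \<longrightarrow> P = I_plus M A \<or> P = I_plus M B)}"


section \<open>Ordered locales\<close>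

text \<open>The frame of an ordered locale as an ordered structure in the sense of HOL-Algebra (with
  joins and bottom given by its order), extended by the additional preorder \<open>trile\<close> on the frame.\<close>

record 'u olocale = "'u gorder" +
  trile :: "'u \<Rightarrow> 'u \<Rightarrow> bool"

definition up_cone :: "'u olocale \<Rightarrow> 'u \<Rightarrow> 'u" where
  "up_cone L U = \<Squnion>\<^bsub>L\<^esub> {V \<in> carrier L. trile L U V}"

definition down_cone :: "'u olocale \<Rightarrow> 'u \<Rightarrow> 'u" where
  "down_cone L U = \<Squnion>\<^bsub>L\<^esub> {W \<in> carrier L. trile L W U}"

definition locale_IP :: "'u olocale \<Rightarrow> 'u set" where
  "locale_IP L = {P \<in> carrier L. P \<noteq> \<bottom>\<^bsub>L\<^esub> \<and> P = down_cone L P \<and>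
     (\<forall>U\<in>carrier L. \<forall>V\<in>carrier L. P = down_cone L U \<squnion>\<^bsub>L\<^esub> down_cone L V \<longrightarrow>
        P = down_cone L U \<or> P = down_cone L V)}"

definition locale_IF :: "'u olocale \<Rightarrow> 'u set" where
  "locale_IF L = {P \<in> carrier L. P \<noteq> \<bottom>\<^bsub>L\<^esub> \<and> P = up_cone L P \<and>
     (\<forall>U\<in>carrier L. \<forall>V\<in>carrier L. P = up_cone L U \<squnion>\<^bsub>L\<^esub> up_cone L V \<longrightarrow>
        P = up_cone L U \<or> P = up_cone L V)}"

definition spacetime_olocale :: "('a, 'e::euclidean_space) spacetime \<Rightarrow> 'a set olocale" where
  "spacetime_olocale M = \<lparr>carrier = {U. openin (pts M) U}, eq = (=), le = (\<subseteq>),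
     trile = (\<lambda>U V. U \<subseteq> J_minus M V \<and> V \<subseteq> J_plus M U)\<rparr>"

definition negneg :: "'a topology \<Rightarrow> 'a set \<Rightarrow> 'a set" where
  "negneg X U = X interior_of (X closure_of U)"

text \<open>The double-negation sublocale of an ordered locale of open sets of \<open>X\<close>. Its preorder is
  induced along the sublocale inclusion, whose inverse image map is \<open>negneg X\<close>.\<close>

definition dneg_olocale :: "'a topology \<Rightarrow> 'a set olocale \<Rightarrow> 'a set olocale" where
  "dneg_olocale X L = \<lparr>carrier = {U \<in> carrier L. U = negneg X U}, eq = (=), le = (\<subseteq>),
     trile = (\<lambda>U U'.
       (\<forall>V\<in>carrier L. U \<subseteq> negneg X V \<longrightarrow> (\<exists>V'\<in>carrier L. trile L V V' \<and> U' \<subseteq> negneg X V')) \<and>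
       (\<forall>V'\<in>carrier L. U' \<subseteq> negneg X V' \<longrightarrow> (\<exists>V\<in>carrier L. trile L V V' \<and> U \<subseteq> negneg X V)))\<rparr>"

definition spacetime_dneg :: "('a, 'e::euclidean_space) spacetime \<Rightarrow> 'a set olocale" where
  "spacetime_dneg M = dneg_olocale (pts M) (spacetime_olocale M)"

lemma negneg_idem: "negneg X (negneg X U) = negneg X U"
proof
  show "negneg X (negneg X U) \<subseteq> negneg X U"
    unfolding negneg_def
    by (intro interior_of_mono closure_of_minimal) (auto simp: interior_of_subset)
  show "negneg X U \<subseteq> negneg X (negneg X U)"
    unfolding negneg_def
    by (intro interior_of_maximal openin_interior_of closure_of_subset)
       (meson interior_of_subset_topspace)
qed

lemma negneg_le: "openin X U \<Longrightarrow> U \<subseteq> negneg X U"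
  unfolding negneg_def
  by (intro interior_of_maximal closure_of_subset) (auto dest: openin_subset)

lemma spacetime_dneg_join:
  assumes "S \<subseteq> carrier (spacetime_dneg M)"
  shows "\<Squnion>\<^bsub>spacetime_dneg M\<^esub> S = negneg (pts M) (\<Union>S)"
proof -
  let ?L = "spacetime_dneg M" and ?j = "negneg (pts M) (\<Union>S)"
  have car: "carrier ?L = {U. openin (pts M) U \<and> U = negneg (pts M) U}"
    by (simp add: spacetime_dneg_def dneg_olocale_def spacetime_olocale_def)
  have le: "le ?L = (\<subseteq>)" by (simp add: spacetime_dneg_def dneg_olocale_def)
  have j: "?j \<in> carrier ?L"
    unfolding car by (simp add: negneg_idem) (simp add: negneg_def)
  have op: "openin (pts M) (\<Union>S)" using assms car by auto
  have up: "?j \<subseteq> V" if "V \<in> carrier ?L" "\<Union>S \<subseteq> V" for V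
  proof -
    have "?j \<subseteq> negneg (pts M) V"
      unfolding negneg_def by (intro interior_of_mono closure_of_mono that)
    then show ?thesis using that(1) car by auto
  qed
  have least: "least ?L ?j (Upper ?L S)"
    using j negneg_le[OF op] up assms unfolding least_def Upper_def le by blast
  moreover have "x = ?j" if "least ?L x (Upper ?L S)" for x
    using that least unfolding least_def le by blast
  ultimately show ?thesis unfolding Lattice.sup_def by (metis someI)
qed

end

theory Submission
  imports Defs
begin

text \<open>The bijection sends \<open>P\<close> to its regularisation \<open>\<not>\<not>P\<close>, with inverse \<open>Q \<mapsto> I\<^sup>-(Q)\<close>. Since futures of
  points are open, \<open>I\<^sup>-(\<not>\<not>U) = I\<^sup>-(U)\<close> for open \<open>U\<close>; and since \<open>J\<^sup>\<plusminus>(U) = I\<^sup>\<plusminus>(U)\<close> for open \<open>U\<close>, the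
  induced preorder on regular opens reads \<open>U \<subseteq> \<not>\<not>I\<^sup>-(V)\<close> and \<open>V \<subseteq> \<not>\<not>I\<^sup>+(U)\<close>, so that the down cone
  of \<open>U\<close> is \<open>\<not>\<not>I\<^sup>-(U)\<close>. The geometric input, \<open>J\<^sup>+(U) = I\<^sup>+(U)\<close>, comes from deforming short causal
  curves in a chart and a bisection argument along the curve. The statement for \<open>IF\<close> follows by
  reversing the time orientation.\<close>

section \<open>Causal vectors of a Lorentz form\<close>

text \<open>A causal curve may be null, so it has no slack of its own, and its end point has to stay
  where it is. All the freedom lies at the start: an open set of starting points lets the curve
  begin slightly earlier and gain a timelike component on the way. This is why the comparison of J
  and I is made for open sets and not for points. The gain beats the variation of the metric only on
  short parameter intervals. Deformed pieces are therefore never glued together. What travels along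
  the curve is membership in an open set that is closed under timelike steps, and the set
  \<open>I_plus M U\<close> is of this kind.

  On the order side, \<open>P = I_minus M P\<close> makes \<open>P\<close> recoverable from its
  regularisation, while being one's own down cone in the sublocale says that \<open>Q\<close> is the
  regularisation of \<open>I_minus M Q\<close>. Both composites of the two maps are then identities,
  and a decomposition is moved to the other side by applying one of the two operators to it.\<close>

lemma lorentz_form_time_coordinate:
  fixes B :: "'e::euclidean_space \<Rightarrow> 'e \<Rightarrow> real"
  assumes "lorentz_form B"
  obtains f :: "'e \<Rightarrow> real" where
    "\<And>T v. \<lbrakk>B T T < 0; B v v \<le> 0; v \<noteq> 0\<rbrakk> \<Longrightarrow> f T \<noteq> 0 \<and> f v \<noteq> 0 \<and> (B v T < 0 \<longleftrightarrow> 0 < f v * f T)"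
proof -
  from assms obtain E :: "'e \<Rightarrow> 'e" and t where bil: "bilinear B" and E: "linear E" "bij E"
    and t: "t \<in> Basis"
    and diag: "\<And>i j. i \<in> Basis \<Longrightarrow> j \<in> Basis \<Longrightarrow>
      B (E i) (E j) = (if i \<noteq> j then 0 else if i = t then -1 else 1)"
    unfolding lorentz_form_def by blast
  \<comment> \<open>\<open>F\<close> reads off coordinates in the frame \<open>E\<close>; in them
    \<open>B\<close> is the standard Minkowski form, as \<open>expand\<close> records.\<close>
  obtain F where F: "linear F" "\<And>v. E (F v) = v"
    using E by (metis bij_is_surj comp_eq_dest_lhs id_apply linear_surjective_right_inverse)
  let ?S = "Basis - {t}"
  have expand: "B v w = (\<Sum>i\<in>?S. (F v \<bullet> i) * (F w \<bullet> i)) - (F v \<bullet> t) * (F w \<bullet> t)" for v w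
  proof -
    have rep: "v = (\<Sum>i\<in>Basis. (F v \<bullet> i) *\<^sub>R E i)" for v
      using F(2)[of v] euclidean_representation[of "F v"] linear_sum[OF E(1)] linear_cmul[OF E(1)]
      by (metis (no_types, lifting) sum.cong)
    have "B v w = B (\<Sum>i\<in>Basis. (F v \<bullet> i) *\<^sub>R E i) (\<Sum>j\<in>Basis. (F w \<bullet> j) *\<^sub>R E j)"
      by (rule arg_cong2[OF rep rep])
    also have "\<dots> = (\<Sum>i\<in>Basis. \<Sum>j\<in>Basis. (F v \<bullet> i) * (F w \<bullet> j) * B (E i) (E j))"
      by (simp add: bilinear_sum[OF bil] bilinear_lmul[OF bil] bilinear_rmul[OF bil]
          sum.cartesian_product mult_ac)
    also have "\<dots> = (\<Sum>i\<in>Basis. (F v \<bullet> i) * (F w \<bullet> i) * (if i = t then -1 else 1))"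
    proof (rule sum.cong[OF refl])
      fix i :: 'e assume i: "i \<in> Basis"
      have "(\<Sum>j\<in>Basis. (F v \<bullet> i) * (F w \<bullet> j) * B (E i) (E j)) =
          (\<Sum>j\<in>Basis. if j = i then (F v \<bullet> i) * (F w \<bullet> i) * (if i = t then -1 else 1) else 0)"
        by (rule sum.cong) (auto simp: diag i)
      then show "(\<Sum>j\<in>Basis. (F v \<bullet> i) * (F w \<bullet> j) * B (E i) (E j)) =
          (F v \<bullet> i) * (F w \<bullet> i) * (if i = t then -1 else 1)"
        using i by simp
    qed
    also have "\<dots> = (F v \<bullet> t) * (F w \<bullet> t) * -1 + (\<Sum>i\<in>?S. (F v \<bullet> i) * (F w \<bullet> i))"
      by (subst sum.remove[OF finite_Basis t]) simp
    finally show ?thesis by simp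
  qed
  show ?thesis
  \<comment> \<open>The witness is the time coordinate \<lambda>v. F v \<bullet> t, found by
    unification with the last \<open>show\<close>.\<close>
  proof (rule that)
    fix T v :: 'e assume T: "B T T < 0" and v: "B v v \<le> 0" and nz: "v \<noteq> 0"
    define p q r where "p = (\<Sum>i\<in>?S. (F v \<bullet> i)\<^sup>2)" and "q = (\<Sum>i\<in>?S. (F T \<bullet> i)\<^sup>2)"
      and "r = (\<Sum>i\<in>?S. (F v \<bullet> i) * (F T \<bullet> i))"
    have qT: "q < (F T \<bullet> t)\<^sup>2" and pv: "p \<le> (F v \<bullet> t)\<^sup>2"
      using T v by (simp_all add: expand p_def q_def power2_eq_square)
    have nonneg: "0 \<le> p" "0 \<le> q" by (simp_all add: p_def q_def sum_nonneg)
    have CS: "r\<^sup>2 \<le> p * q" unfolding r_def p_def q_def by (rule Cauchy_Schwarz_ineq_sum)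
    have fT: "F T \<bullet> t \<noteq> 0" using qT nonneg by auto
    have fv: "F v \<bullet> t \<noteq> 0"
    proof
      assume 0: "F v \<bullet> t = 0"
      with pv nonneg have "p = 0" by simp
      then have "\<forall>i\<in>?S. F v \<bullet> i = 0" by (simp add: p_def sum_nonneg_eq_0_iff)
      with 0 have "F v = 0" by (metis Diff_iff euclidean_all_zero_iff singletonD)
      then show False using nz F(2)[of v] linear_0[OF E(1)] by simp
    qed
    \<comment> \<open>Reversed Cauchy-Schwarz: against a timelike \<open>T\<close> the spatial part
      \<open>r\<close> is strictly smaller in modulus than the product of the time coordinates, so
      that product alone decides the sign of \<open>B v T\<close>. Strictness rests on
      \<open>fv\<close>.\<close>
    have "p * q \<le> (F v \<bullet> t)\<^sup>2 * q" using pv nonneg by (intro mult_right_mono)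
    also have "\<dots> < (F v \<bullet> t)\<^sup>2 * (F T \<bullet> t)\<^sup>2" using qT fv by simp
    finally have "r\<^sup>2 < ((F v \<bullet> t) * (F T \<bullet> t))\<^sup>2" using CS by (simp add: power_mult_distrib)
    then have "\<bar>r\<bar> < \<bar>(F v \<bullet> t) * (F T \<bullet> t)\<bar>" using power2_less_imp_less[of "\<bar>r\<bar>" "\<bar>(F v \<bullet> t) * (F T \<bullet> t)\<bar>"] by simp
    moreover have "B v T = r - (F v \<bullet> t) * (F T \<bullet> t)" by (simp add: expand r_def)
    ultimately have "B v T < 0 \<longleftrightarrow> 0 < (F v \<bullet> t) * (F T \<bullet> t)" by argo
    with fT fv show "F T \<bullet> t \<noteq> 0 \<and> F v \<bullet> t \<noteq> 0 \<and> (B v T < 0 \<longleftrightarrow> 0 < (F v \<bullet> t) * (F T \<bullet> t))" by blast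
  qed
qed

text \<open>The time coordinates of \<open>S\<close> and \<open>T\<close> have the same sign, so
  multiplying either by that of \<open>v\<close> gives the same sign. This permits testing future
  direction with any convenient vector in place of the orientation field.\<close>

lemma lorentz_form_same_cone:
  fixes B :: "'e::euclidean_space \<Rightarrow> 'e \<Rightarrow> real"
  assumes "lorentz_form B" "B S S < 0" "B T T < 0" "B T S < 0" "B v v \<le> 0" "v \<noteq> 0"
  shows "B v T < 0 \<longleftrightarrow> B v S < 0"
proof -
  obtain f :: "'e \<Rightarrow> real" where f: "\<And>T v. \<lbrakk>B T T < 0; B v v \<le> 0; v \<noteq> 0\<rbrakk> \<Longrightarrow> f T \<noteq> 0 \<and> f v \<noteq> 0 \<and> (B v T < 0 \<longleftrightarrow> 0 < f v * f T)"
    by (rule lorentz_form_time_coordinate[OF assms(1)]) blast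
  have "bilinear B" using assms(1) by (simp add: lorentz_form_def)
  then have "T \<noteq> 0" using assms(3) bilinear_lzero[of B] by auto
  then have "0 < f T * f S" using f[of S T] assms by auto
  then show ?thesis using f[of S v] f[of T v] assms by (auto simp: zero_less_mult_iff)
qed

section \<open>First derivatives of smooth maps, and families of linear maps\<close>

lemma smooth_on_differentiable:
  assumes "smooth_on S f" "x \<in> S"
  shows "f differentiable (at x)"
  using assms(1)[unfolded smooth_on_def, rule_format, of "Suc 0"] assms(2) by simp

lemma smooth_on_continuous_derivative:
  assumes "smooth_on S f"
  shows "continuous_on S (\<lambda>x. frechet_derivative f (at x) v)"
  using assms[unfolded smooth_on_def, rule_format, of "Suc 0"] by simp

text \<open>In finite dimension the argument can be expanded in the basis, so continuity for each
  frozen argument yields continuity with a moving one.\<close>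

lemma continuous_on_linear_family:
  fixes D :: "'b::topological_space \<Rightarrow> 'e::euclidean_space \<Rightarrow> 'f::real_normed_vector"
  assumes "\<And>x. x \<in> S \<Longrightarrow> linear (D x)" "\<And>v. continuous_on S (\<lambda>x. D x v)" "continuous_on S w"
  shows "continuous_on S (\<lambda>x. D x (w x))"
proof -
  have "continuous_on S (\<lambda>x. \<Sum>i\<in>Basis. (w x \<bullet> i) *\<^sub>R D x i)"
    by (intro continuous_intros assms)
  moreover have "(\<Sum>i\<in>Basis. (w x \<bullet> i) *\<^sub>R D x i) = D x (w x)" if "x \<in> S" for x
    using linear_sum[OF assms(1)[OF that], of "\<lambda>i. (w x \<bullet> i) *\<^sub>R i" Basis]
      linear_cmul[OF assms(1)[OF that]] euclidean_representation[of "w x"] by simp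
  ultimately show ?thesis by (simp cong: continuous_on_cong)
qed

section \<open>Charts and the metric in coordinates\<close>

text \<open>As a locale, the theory can be instantiated at \<open>reverse M\<close> too; this is how
  time-dual facts are obtained.\<close>

locale lorentz_spacetime =
  fixes M :: "('a, 'e::euclidean_space) spacetime"
  assumes smooth_spacetime: "smooth_spacetime M"
begin

abbreviation X where "X \<equiv> pts M"
abbreviation \<A> where "\<A> \<equiv> atlas M"
abbreviation coords :: "('a, 'e) chart \<Rightarrow> 'e set" where "coords c \<equiv> snd c ` fst c"
abbreviation G :: "('a, 'e) chart \<Rightarrow> 'e \<Rightarrow> 'e \<Rightarrow> 'e \<Rightarrow> real" where
  "G c x \<equiv> metric_coord M c (coord_inv c x)"
abbreviation orient_coord :: "('a, 'e) chart \<Rightarrow> 'e \<Rightarrow> 'e" where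
  "orient_coord c x \<equiv> orient M (coord_inv c x) c"

lemma is_chart: "c \<in> \<A> \<Longrightarrow> is_chart X c"
  using smooth_spacetime by (simp add: smooth_spacetime_def smooth_manifold_def smooth_atlas_def)

lemma openin_chart: "c \<in> \<A> \<Longrightarrow> openin X (fst c)"
  using is_chart by (simp add: is_chart_def)

lemma open_coords: "c \<in> \<A> \<Longrightarrow> open (coords c)"
  using is_chart by (simp add: is_chart_def)

lemma homeomorphic_map_chart:
  "c \<in> \<A> \<Longrightarrow> homeomorphic_map (subtopology X (fst c)) (top_of_set (coords c)) (snd c)"
  using is_chart by (simp add: is_chart_def)

lemma topspace_chart: "c \<in> \<A> \<Longrightarrow> topspace (subtopology X (fst c)) = fst c"
  by (metis openin_chart openin_subset topspace_subtopology_subset)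

lemma chart_cover: "p \<in> topspace X \<Longrightarrow> \<exists>c\<in>\<A>. p \<in> fst c"
proof -
  assume p: "p \<in> topspace X"
  have "\<Union> (fst ` \<A>) = topspace X"
    using smooth_spacetime by (simp add: smooth_spacetime_def smooth_manifold_def smooth_atlas_def)
  with p show ?thesis by blast
qed

lemma inj_on_chart: "c \<in> \<A> \<Longrightarrow> inj_on (snd c) (fst c)"
  using homeomorphic_map_chart[of c] topspace_chart[of c] by (simp add: homeomorphic_eq_everything_map)

lemma coord_inv_chart [simp]: "c \<in> \<A> \<Longrightarrow> p \<in> fst c \<Longrightarrow> coord_inv c (snd c p) = p"
  using inj_on_chart by (simp add: coord_inv_def)

lemma coord_inv_in: "x \<in> coords c \<Longrightarrow> coord_inv c x \<in> fst c"
  by (simp add: coord_inv_def inv_into_into)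

lemma chart_coord_inv: "x \<in> coords c \<Longrightarrow> snd c (coord_inv c x) = x"
  by (simp add: coord_inv_def f_inv_into_f)

lemma continuous_map_chart:
  "c \<in> \<A> \<Longrightarrow> continuous_map (subtopology X (fst c)) (top_of_set (coords c)) (snd c)"
  using homeomorphic_map_chart homeomorphic_imp_continuous_map by blast

lemma continuous_map_coord_inv:
  assumes c: "c \<in> \<A>"
  shows "continuous_map (top_of_set (coords c)) (subtopology X (fst c)) (coord_inv c)"
proof -
  obtain g where g: "homeomorphic_maps (subtopology X (fst c)) (top_of_set (coords c)) (snd c) g"
    using homeomorphic_map_chart[OF c] homeomorphic_map_maps by blast
  then have cont: "continuous_map (top_of_set (coords c)) (subtopology X (fst c)) g"
    and inv: "\<And>p. p \<in> fst c \<Longrightarrow> g (snd c p) = p"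
    using topspace_chart[OF c] by (auto simp: homeomorphic_maps_def)
  from cont show ?thesis by (rule continuous_map_eq) (auto simp: inv c)
qed

lemma open_chart_image:
  assumes c: "c \<in> \<A>" and U: "openin X U"
  shows "open (snd c ` (fst c \<inter> U))"
proof -
  have "openin (subtopology X (fst c)) (fst c \<inter> U)"
    using U by (simp add: openin_subtopology_Int2)
  then have "openin (top_of_set (coords c)) (snd c ` (fst c \<inter> U))"
    using homeomorphic_imp_open_map[OF homeomorphic_map_chart[OF c]] by (simp add: open_map_def)
  then show ?thesis using open_coords[OF c] openin_open_eq by blast
qed

lemma openin_coord_inv_image:
  assumes c: "c \<in> \<A>" and S: "open S" "S \<subseteq> coords c"
  shows "openin X (coord_inv c ` S)"
proof -
  have "openin (subtopology X (fst c)) {p \<in> topspace (subtopology X (fst c)). snd c p \<in> S}"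
    using continuous_map_chart[OF c] S by (intro openin_continuous_map_preimage) (auto simp: openin_open_eq open_coords[OF c])
  moreover have "{p \<in> topspace (subtopology X (fst c)). snd c p \<in> S} = coord_inv c ` S"
  proof
    show "{p \<in> topspace (subtopology X (fst c)). snd c p \<in> S} \<subseteq> coord_inv c ` S"
    proof
      fix p assume "p \<in> {p \<in> topspace (subtopology X (fst c)). snd c p \<in> S}"
      then have "p = coord_inv c (snd c p)" "snd c p \<in> S" by (simp_all add: c topspace_chart)
      then show "p \<in> coord_inv c ` S" by blast
    qed
    show "coord_inv c ` S \<subseteq> {p \<in> topspace (subtopology X (fst c)). snd c p \<in> S}"
    proof (rule image_subsetI)
      fix x assume x: "x \<in> S"
      have "x \<in> coords c" by (rule subsetD[OF S(2) x])
      then show "coord_inv c x \<in> {p \<in> topspace (subtopology X (fst c)). snd c p \<in> S}"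
        using x unfolding topspace_chart[OF c] by (simp add: coord_inv_in chart_coord_inv)
    qed
  qed
  ultimately have "openin (subtopology X (fst c)) (coord_inv c ` S)" by (simp only:)
  then show ?thesis using openin_trans_full openin_chart[OF c] by blast
qed

section \<open>Transition maps and tangent vectors\<close>

lemma transition_chart: "c \<in> \<A> \<Longrightarrow> p \<in> fst c \<Longrightarrow> transition c d (snd c p) = snd d p"
  by (simp add: transition_def)

lemma smooth_on_transition:
  "c \<in> \<A> \<Longrightarrow> d \<in> \<A> \<Longrightarrow> smooth_on (snd c ` (fst c \<inter> fst d)) (transition c d)"
  using smooth_spacetime by (simp add: smooth_spacetime_def smooth_manifold_def smooth_atlas_def)

lemma has_derivative_transition:
  assumes "c \<in> \<A>" "d \<in> \<A>" "p \<in> fst c" "p \<in> fst d"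
  shows "(transition c d has_derivative frechet_derivative (transition c d) (at (snd c p))) (at (snd c p))"
  using smooth_on_differentiable[OF smooth_on_transition] assms frechet_derivative_works by blast

text \<open>Chain rule, with an agreement that is only local: on the overlap of \<open>c\<close> and
  \<open>d\<close>, which is open in coordinates, both maps send the coordinates of a point to its
  \<open>e\<close>-coordinates.\<close>

lemma transition_derivative_comp:
  assumes c: "c \<in> \<A>" and d: "d \<in> \<A>" and e: "e \<in> \<A>" and p: "p \<in> fst c" "p \<in> fst d" "p \<in> fst e"
  shows "frechet_derivative (transition d e) (at (snd d p)) (frechet_derivative (transition c d) (at (snd c p)) a)
    = frechet_derivative (transition c e) (at (snd c p)) a"
proof -
  let ?D = "frechet_derivative (transition d e) (at (snd d p)) \<circ> frechet_derivative (transition c d) (at (snd c p))"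
  have "(transition d e \<circ> transition c d has_derivative ?D) (at (snd c p))"
    using has_derivative_transition[OF c d p(1,2)] has_derivative_transition[OF d e p(2,3)]
    by (intro diff_chain_at) (simp_all add: transition_chart c p)
  moreover have "(transition d e \<circ> transition c d) x = transition c e x"
    if "x \<in> snd c ` (fst c \<inter> fst d)" for x
    using that by (auto simp: transition_chart c d)
  ultimately have "(transition c e has_derivative ?D) (at (snd c p))"
    using open_chart_image[OF c openin_chart[OF d]] p
    by (elim has_derivative_transform_within_open[where s = "snd c ` (fst c \<inter> fst d)"]) auto
  then have "frechet_derivative (transition c e) (at (snd c p)) = ?D"
    by (rule frechet_derivative_at[symmetric])
  then show ?thesis by simp
qed

lemma transition_derivative_self:
  assumes c: "c \<in> \<A>" and p: "p \<in> fst c"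
  shows "frechet_derivative (transition c c) (at (snd c p)) a = a"
proof -
  have "(transition c c has_derivative (\<lambda>a. a)) (at (snd c p))"
    using open_coords[OF c] p
    by (intro has_derivative_transform_within_open[OF has_derivative_ident, where s = "coords c"])
      (auto simp: transition_chart c)
  then show ?thesis using frechet_derivative_at by metis
qed

lemma linear_transition_derivative:
  assumes "c \<in> \<A>" "d \<in> \<A>" "p \<in> fst c" "p \<in> fst d"
  shows "linear (frechet_derivative (transition c d) (at (snd c p)))"
  using has_derivative_transition[OF assms] has_derivative_linear by blast

lemma coord_vec_same: "c \<in> \<A> \<Longrightarrow> p \<in> fst c \<Longrightarrow> coord_vec \<A> c p a c = a"
  by (simp add: coord_vec_def charts_at_def transition_derivative_self)

lemma coord_vec_tangent:
  assumes "v \<in> tangent_space \<A> p" "c \<in> \<A>" "p \<in> fst c"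
  shows "coord_vec \<A> c p (v c) = v"
proof
  fix d
  have "v d = 0" if "d \<notin> charts_at \<A> p"
    using assms(1) that unfolding tangent_space_def by blast
  moreover have "v d = frechet_derivative (transition c d) (at (snd c p)) (v c)" if "d \<in> charts_at \<A> p"
    using assms that unfolding tangent_space_def charts_at_def by blast
  ultimately show "coord_vec \<A> c p (v c) d = v d"
    unfolding coord_vec_def by presburger
qed

text \<open>Compatibility between charts is the cocycle identity
  \<open>transition_derivative_comp\<close>.\<close>

lemma coord_vec_in_tangent_space:
  assumes c: "c \<in> \<A>" and p: "p \<in> fst c"
  shows "coord_vec \<A> c p a \<in> tangent_space \<A> p"
  unfolding tangent_space_def
proof (intro CollectI conjI allI impI ballI)
  fix d e assume "d \<in> charts_at \<A> p" "e \<in> charts_at \<A> p"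
  then show "coord_vec \<A> c p a e = frechet_derivative (transition d e) (at (snd d p)) (coord_vec \<A> c p a d)"
    using transition_derivative_comp[OF c _ _ p] by (simp add: coord_vec_def charts_at_def)
qed (simp add: coord_vec_def)

lemma coord_vec_uminus:
  assumes c: "c \<in> \<A>" and p: "p \<in> fst c"
  shows "coord_vec \<A> c p (- a) = (\<lambda>d. - coord_vec \<A> c p a d)"
  using linear_neg[OF linear_transition_derivative[OF c _ p]]
  by (auto simp: coord_vec_def charts_at_def fun_eq_iff)

section \<open>The metric and its future cones in coordinates\<close>

lemma lorentz_form_coord: "c \<in> \<A> \<Longrightarrow> p \<in> fst c \<Longrightarrow> lorentz_form (metric_coord M c p)"
  using smooth_spacetime by (simp add: smooth_spacetime_def lorentzian_metric_def)

lemma bilinear_coord: "c \<in> \<A> \<Longrightarrow> p \<in> fst c \<Longrightarrow> bilinear (metric_coord M c p)"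
  using lorentz_form_coord by (auto simp: lorentz_form_def)

lemma smooth_on_G: "c \<in> \<A> \<Longrightarrow> smooth_on (coords c) (\<lambda>x. G c x a b)"
  using smooth_spacetime by (simp add: smooth_spacetime_def lorentzian_metric_def)

lemma metric_tangent:
  assumes "v \<in> tangent_space \<A> p" "w \<in> tangent_space \<A> p" "c \<in> \<A>" "p \<in> fst c"
  shows "metric M p v w = metric_coord M c p (v c) (w c)"
  using assms by (simp add: metric_coord_def coord_vec_tangent)

lemma orient_tangent: "p \<in> topspace X \<Longrightarrow> orient M p \<in> tangent_space \<A> p"
  using smooth_spacetime
  by (simp add: smooth_spacetime_def time_orientation_def timelike_vector_def)

lemma chart_subset: "c \<in> \<A> \<Longrightarrow> fst c \<subseteq> topspace X"
  using openin_chart openin_subset by blast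

lemma orient_timelike:
  assumes "c \<in> \<A>" "p \<in> fst c"
  shows "metric_coord M c p (orient M p c) (orient M p c) < 0"
proof -
  have p: "p \<in> topspace X" using assms chart_subset by blast
  then have "timelike_vector M p (orient M p)"
    using smooth_spacetime by (simp add: smooth_spacetime_def time_orientation_def)
  then show ?thesis
    using metric_tangent[OF orient_tangent orient_tangent] p assms by (simp add: timelike_vector_def)
qed

text \<open>The requirement that the vector be nonzero is absorbed: a strict inequality for a
  bilinear form excludes 0.\<close>

lemma future_timelike_coord:
  assumes v: "v \<in> tangent_space \<A> p" and c: "c \<in> \<A>" "p \<in> fst c"
  shows "future_timelike M p v \<longleftrightarrow>
    metric_coord M c p (v c) (v c) < 0 \<and> metric_coord M c p (v c) (orient M p c) < 0"
proof -
  have "p \<in> topspace X" using c chart_subset by blast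
  then show ?thesis
    using metric_tangent[OF v v c] metric_tangent[OF v orient_tangent c] v
      bilinear_lzero[OF bilinear_coord[OF c]]
    by (auto simp: future_timelike_def timelike_vector_def)
qed

lemma future_causal_coord:
  assumes v: "v \<in> tangent_space \<A> p" and c: "c \<in> \<A>" "p \<in> fst c"
  shows "future_causal M p v \<longleftrightarrow>
    metric_coord M c p (v c) (v c) \<le> 0 \<and> metric_coord M c p (v c) (orient M p c) < 0"
proof -
  have "p \<in> topspace X" using c chart_subset by blast
  then show ?thesis
    using metric_tangent[OF v v c] metric_tangent[OF v orient_tangent c] v
      bilinear_lzero[OF bilinear_coord[OF c]]
    by (auto simp: future_causal_def causal_vector_def)
qed

lemma future_causal_tangent: "future_causal M p v \<Longrightarrow> v \<in> tangent_space \<A> p"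
  by (simp add: future_causal_def causal_vector_def)

lemma future_timelike_imp_causal: "future_timelike M p v \<Longrightarrow> future_causal M p v"
  by (auto simp: future_timelike_def future_causal_def timelike_vector_def causal_vector_def)

lemma continuous_on_orient_coord:
  assumes c: "c \<in> \<A>"
  shows "continuous_on (coords c) (orient_coord c)"
proof -
  have "continuous_map (subtopology X (fst c)) euclidean (\<lambda>p. orient M p c)"
    using smooth_spacetime c by (simp add: smooth_spacetime_def time_orientation_def)
  from continuous_map_compose[OF continuous_map_coord_inv[OF c] this]
  show ?thesis by (simp add: o_def)
qed

text \<open>Smoothness of the metric is given with both vector arguments frozen;
  \<open>continuous_on_linear_family\<close>, once for each slot, frees them.\<close>

lemma continuous_on_G:
  assumes c: "c \<in> \<A>" and x: "continuous_on S x" "x ` S \<subseteq> coords c"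
    and ab: "continuous_on S a" "continuous_on S b"
  shows "continuous_on S (\<lambda>s. G c (x s) (a s) (b s))"
proof -
  have G: "continuous_on S (\<lambda>s. G c (x s) v w)" for v w
  proof -
    have "continuous_on (coords c) (\<lambda>x. G c x v w)"
      using smooth_on_G[OF c] smooth_on_differentiable
      by (metis differentiable_imp_continuous_within continuous_at_imp_continuous_on)
    from continuous_on_compose2[OF this x] show ?thesis .
  qed
  have bil: "bilinear (G c (x s))" if "s \<in> S" for s
    using that x(2) bilinear_coord[OF c] coord_inv_in by blast
  have "continuous_on S (\<lambda>s. G c (x s) (a s) w)" for w
    using bil unfolding bilinear_def
    by (intro continuous_on_linear_family[of S "\<lambda>s v. G c (x s) v w", OF _ G ab(1)]) blast
  then show ?thesis
    using bil unfolding bilinear_def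
    by (intro continuous_on_linear_family[of S "\<lambda>s. G c (x s) (a s)", OF _ _ ab(2)]) blast+
qed

text \<open>The bundle of open future cones over a chart, placed in a product space: a coordinate
  curve is future timelike when position and velocity together stay in this set, and its openness
  allows both to be perturbed at once.\<close>

definition future_cone :: "('a, 'e) chart \<Rightarrow> ('e \<times> 'e) set" where
  "future_cone c = {(x, w). x \<in> coords c \<and> G c x w w < 0 \<and> G c x w (orient_coord c x) < 0}"

lemma open_future_cone:
  assumes c: "c \<in> \<A>"
  shows "open (future_cone c)"
proof -
  let ?S = "coords c \<times> UNIV :: ('e \<times> 'e) set"
  have S: "open ?S" using open_coords[OF c] by (simp add: open_Times)
  have 1: "continuous_on ?S (\<lambda>z. G c (fst z) (snd z) (snd z))"
    by (intro continuous_on_G[OF c] continuous_intros) auto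
  have 2: "continuous_on ?S (\<lambda>z. G c (fst z) (snd z) (orient_coord c (fst z)))"
    by (intro continuous_on_G[OF c] continuous_intros
        continuous_on_compose2[OF continuous_on_orient_coord[OF c]]) auto
  have "open (?S \<inter> (\<lambda>z. G c (fst z) (snd z) (snd z)) -` {..<0})"
       "open (?S \<inter> (\<lambda>z. G c (fst z) (snd z) (orient_coord c (fst z))) -` {..<0})"
    using continuous_open_preimage[OF 1 S, of "{..<0}"] continuous_open_preimage[OF 2 S, of "{..<0}"] by auto
  then have "open ((?S \<inter> (\<lambda>z. G c (fst z) (snd z) (snd z)) -` {..<0}) \<inter>
       (?S \<inter> (\<lambda>z. G c (fst z) (snd z) (orient_coord c (fst z))) -` {..<0}))" by (rule open_Int)
  moreover have "\<dots> = future_cone c" by (auto simp: future_cone_def)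
  ultimately show ?thesis by simp
qed

lemma orient_in_future_cone:
  "c \<in> \<A> \<Longrightarrow> x \<in> coords c \<Longrightarrow> (x, orient_coord c x) \<in> future_cone c"
  using orient_timelike coord_inv_in by (simp add: future_cone_def)

end

section \<open>Piecewise smooth curves as chains of smooth paths\<close>

text \<open>A single \<open>C1_curve\<close> segment seen as a relation between its end points. Both
  causal relations become transitive closures of it, so breakpoints and concatenation are replaced
  by induction on chains.\<close>

definition C1_path ::
    "('a, 'e::euclidean_space) spacetime \<Rightarrow> ('a \<Rightarrow> ('a, 'e) tvec \<Rightarrow> bool) \<Rightarrow> 'a \<Rightarrow> 'a \<Rightarrow> bool" where
  "C1_path M Q x y \<longleftrightarrow> (\<exists>\<gamma> a b. C1_curve M \<gamma> a b \<and>
     (\<forall>t\<in>{a..b}. Q (\<gamma> t) (velocity (atlas M) \<gamma> a b t)) \<and> \<gamma> a = x \<and> \<gamma> b = y)"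

lemma C1_curve_has_vector_derivative:
  assumes "C1_curve M \<gamma> a b" "c \<in> atlas M" "t \<in> {a..b}" "\<gamma> t \<in> fst c"
  shows "((snd c \<circ> \<gamma>) has_vector_derivative velocity (atlas M) \<gamma> a b t c) (at t within {a..b})"
proof -
  have "(snd c \<circ> \<gamma>) differentiable (at t within {a..b})"
    using assms unfolding C1_curve_def by blast
  moreover have "velocity (atlas M) \<gamma> a b t c = vector_derivative (snd c \<circ> \<gamma>) (at t within {a..b})"
    using assms by (simp add: velocity_def charts_at_def)
  ultimately show ?thesis using vector_derivative_works by metis
qed

text \<open>A velocity is a function on all charts, so the candidate \<open>w\<close> must also
  vanish at the charts that miss the point; only then is it equal to \<open>velocity\<close> and not
  just equal in each relevant chart.\<close>

lemma C1_curveI: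
  assumes ab: "a < b" and cont: "continuous_map (top_of_set {a..b}) (pts M) \<gamma>"
    and der: "\<And>c t. c \<in> atlas M \<Longrightarrow> t \<in> {a..b} \<Longrightarrow> \<gamma> t \<in> fst c \<Longrightarrow>
      ((snd c \<circ> \<gamma>) has_vector_derivative w t c) (at t within {a..b})"
    and wcont: "\<And>c. c \<in> atlas M \<Longrightarrow> continuous_on {t\<in>{a..b}. \<gamma> t \<in> fst c} (\<lambda>t. w t c)"
    and w0: "\<And>c t. c \<notin> charts_at (atlas M) (\<gamma> t) \<Longrightarrow> w t c = 0"
  shows "C1_curve M \<gamma> a b" "t \<in> {a..b} \<Longrightarrow> velocity (atlas M) \<gamma> a b t = w t"
proof -
  have vel: "velocity (atlas M) \<gamma> a b t c = w t c" if t: "t \<in> {a..b}" for t c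
  proof (cases "c \<in> charts_at (atlas M) (\<gamma> t)")
    case True
    then have "vector_derivative (snd c \<circ> \<gamma>) (at t within {a..b}) = w t c"
      using t ab der by (intro vector_derivative_within_closed_interval) (simp_all add: charts_at_def)
    with True show ?thesis by (simp add: velocity_def)
  qed (simp add: velocity_def w0)
  then show "t \<in> {a..b} \<Longrightarrow> velocity (atlas M) \<gamma> a b t = w t" by blast
  show "C1_curve M \<gamma> a b"
    unfolding C1_curve_def
  proof (intro conjI ballI ab cont)
    fix c assume c: "c \<in> atlas M"
    show "(snd c \<circ> \<gamma>) differentiable (at t within {a..b})" if "t \<in> {t\<in>{a..b}. \<gamma> t \<in> fst c}" for t
      using der[OF c, of t] that by (auto intro: differentiableI_vector)
    show "continuous_on {t\<in>{a..b}. \<gamma> t \<in> fst c} (\<lambda>t. velocity (atlas M) \<gamma> a b t c)"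
      using wcont[OF c] by (rule continuous_on_eq) (simp add: vel)
  qed
qed

text \<open>Used with \<open>m = 1\<close> to shift and restrict curves, and with
  \<open>m = - 1\<close> to run them backwards.\<close>

lemma C1_curve_affine:
  assumes \<gamma>: "C1_curve M \<gamma> a b" and a'b': "a' < b'"
    and h: "\<And>t. t \<in> {a'..b'} \<Longrightarrow> m * t + k \<in> {a..b}"
    and \<delta>: "\<And>t. t \<in> {a'..b'} \<Longrightarrow> \<delta> t = \<gamma> (m * t + k)"
  shows "C1_curve M \<delta> a' b'"
    and "t \<in> {a'..b'} \<Longrightarrow>
      velocity (atlas M) \<delta> a' b' t = (\<lambda>c. m *\<^sub>R velocity (atlas M) \<gamma> a b (m * t + k) c)"
proof -
  let ?w = "\<lambda>t c. if c \<in> charts_at (atlas M) (\<delta> t) then m *\<^sub>R velocity (atlas M) \<gamma> a b (m * t + k) c else 0"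
  have 1: "continuous_map (top_of_set {a'..b'}) (pts M) \<delta>"
  proof -
    have "continuous_map (top_of_set {a'..b'}) (top_of_set {a..b}) (\<lambda>t. m * t + k)"
      using h by (auto intro!: continuous_intros)
    from continuous_map_compose[OF this] have
      "continuous_map (top_of_set {a'..b'}) (pts M) (\<gamma> \<circ> (\<lambda>t. m * t + k))"
      using \<gamma> unfolding C1_curve_def by blast
    then show ?thesis by (rule continuous_map_eq) (simp add: \<delta>)
  qed
  have 2: "((snd c \<circ> \<delta>) has_vector_derivative ?w t c) (at t within {a'..b'})"
    if c: "c \<in> atlas M" and t: "t \<in> {a'..b'}" and "\<delta> t \<in> fst c" for c t
  proof -
    have \<gamma>t: "\<gamma> (m * t + k) \<in> fst c" using that \<delta> by simp
    have "((\<lambda>t. m * t + k) has_vector_derivative m) (at t within {a'..b'})"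
      by (auto intro!: derivative_eq_intros simp: has_vector_derivative_def)
    moreover have "((snd c \<circ> \<gamma>) has_vector_derivative velocity (atlas M) \<gamma> a b (m * t + k) c)
        (at (m * t + k) within (\<lambda>t. m * t + k) ` {a'..b'})"
      by (rule has_vector_derivative_within_subset[OF C1_curve_has_vector_derivative[OF \<gamma> c h[OF t] \<gamma>t]])
        (use h in blast)
    ultimately have "((snd c \<circ> \<gamma> \<circ> (\<lambda>t. m * t + k)) has_vector_derivative
        m *\<^sub>R velocity (atlas M) \<gamma> a b (m * t + k) c) (at t within {a'..b'})"
      by (rule vector_diff_chain_within)
    then have "((snd c \<circ> \<delta>) has_vector_derivative
        m *\<^sub>R velocity (atlas M) \<gamma> a b (m * t + k) c) (at t within {a'..b'})"
      by (rule has_vector_derivative_transform[OF t, rotated]) (simp add: \<delta>)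
    then show ?thesis using that by (simp add: charts_at_def)
  qed
  have 3: "continuous_on {t\<in>{a'..b'}. \<delta> t \<in> fst c} (\<lambda>t. ?w t c)" if c: "c \<in> atlas M" for c
  proof -
    have "continuous_on {t\<in>{a..b}. \<gamma> t \<in> fst c} (\<lambda>t. velocity (atlas M) \<gamma> a b t c)"
      using \<gamma> c unfolding C1_curve_def by blast
    then have "continuous_on {t\<in>{a'..b'}. \<delta> t \<in> fst c} (\<lambda>t. m *\<^sub>R velocity (atlas M) \<gamma> a b (m * t + k) c)"
      using h \<delta> by (intro continuous_intros continuous_on_compose2[where f = "\<lambda>t. m * t + k"]) auto
    then show ?thesis by (rule continuous_on_eq) (simp add: charts_at_def c)
  qed
  show "C1_curve M \<delta> a' b'" using C1_curveI(1)[OF a'b' 1 2 3] by simp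
  assume t: "t \<in> {a'..b'}"
  have "velocity (atlas M) \<delta> a' b' t = ?w t" using C1_curveI(2)[OF a'b' 1 2 3 _ t] by simp
  also have "\<dots> = (\<lambda>c. m *\<^sub>R velocity (atlas M) \<gamma> a b (m * t + k) c)"
    using \<delta>[OF t] by (auto simp: velocity_def)
  finally show "velocity (atlas M) \<delta> a' b' t = (\<lambda>c. m *\<^sub>R velocity (atlas M) \<gamma> a b (m * t + k) c)" .
qed

lemma C1_path_shift:
  assumes "C1_curve M \<gamma> a b" "\<forall>t\<in>{a..b}. Q (\<gamma> t) (velocity (atlas M) \<gamma> a b t)" "a' < b'"
    and "\<And>t. t \<in> {a'..b'} \<Longrightarrow> t + k \<in> {a..b}" "\<And>t. t \<in> {a'..b'} \<Longrightarrow> \<delta> t = \<gamma> (t + k)"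
  shows "C1_curve M \<delta> a' b' \<and> (\<forall>t\<in>{a'..b'}. Q (\<delta> t) (velocity (atlas M) \<delta> a' b' t))"
  using C1_curve_affine[of M \<gamma> a b a' b' 1 k \<delta>] assms by simp

lemma C1_path_restrict:
  assumes "C1_curve M \<gamma> a b" "\<forall>t\<in>{a..b}. Q (\<gamma> t) (velocity (atlas M) \<gamma> a b t)"
    and "a \<le> s" "s < t" "t \<le> b"
  shows "C1_path M Q (\<gamma> s) (\<gamma> t)"
  unfolding C1_path_def using C1_path_shift[OF assms(1,2,4), of 0 \<gamma>] assms(3,5) by auto

text \<open>Each segment carries its own one-sided velocities, so curves can be joined without any
  matching condition beyond a common end point; only the parameter of the next segment has to be
  shifted.\<close>

lemma piecewise_C1_curve_iff_tranclp:
  "(\<exists>\<gamma> a b. piecewise_C1_curve M Q \<gamma> a b \<and> \<gamma> a = x \<and> \<gamma> b = y) \<longleftrightarrow> (C1_path M Q)\<^sup>+\<^sup>+ x y"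
proof
  assume "\<exists>\<gamma> a b. piecewise_C1_curve M Q \<gamma> a b \<and> \<gamma> a = x \<and> \<gamma> b = y"
  then obtain \<gamma> and n :: nat and s where n: "0 < n" and s: "\<gamma> (s 0) = x" "\<gamma> (s n) = y"
    and seg: "\<And>i. i < n \<Longrightarrow> C1_curve M \<gamma> (s i) (s (Suc i)) \<and>
        (\<forall>t\<in>{s i..s (Suc i)}. Q (\<gamma> t) (velocity (atlas M) \<gamma> (s i) (s (Suc i)) t))"
    unfolding piecewise_C1_curve_def by blast
  have step: "C1_path M Q (\<gamma> (s i)) (\<gamma> (s (Suc i)))" if "i < n" for i
    using seg[OF that] unfolding C1_path_def by blast
  have "(C1_path M Q)\<^sup>+\<^sup>+ x (\<gamma> (s (Suc i)))" if "i < n" for i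
    using that
  proof (induction i)
    case 0
    then show ?case using step[of 0] s by auto
  next
    case (Suc i)
    then show ?case using step[of "Suc i"] by (metis Suc_lessD tranclp.trancl_into_trancl)
  qed
  from this[of "n - 1"] show "(C1_path M Q)\<^sup>+\<^sup>+ x y" using n s by simp
next
  assume "(C1_path M Q)\<^sup>+\<^sup>+ x y"
  then show "\<exists>\<gamma> a b. piecewise_C1_curve M Q \<gamma> a b \<and> \<gamma> a = x \<and> \<gamma> b = y"
  proof (induction rule: tranclp_induct)
    case (base y)
    then obtain \<gamma> a b where \<gamma>: "C1_curve M \<gamma> a b" "\<gamma> a = x" "\<gamma> b = y"
      "\<forall>t\<in>{a..b}. Q (\<gamma> t) (velocity (atlas M) \<gamma> a b t)"
      unfolding C1_path_def by blast
    then have "piecewise_C1_curve M Q \<gamma> a b" unfolding piecewise_C1_curve_def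
      by (intro exI[of _ 1] exI[of _ "\<lambda>i. if i = 0 then a else b"]) simp
    with \<gamma> show ?case by blast
  next
    case (step y z)
    then obtain \<gamma> and n :: nat and s where n: "0 < n" and s: "\<gamma> (s 0) = x" "\<gamma> (s n) = y"
      and seg: "\<And>i. i < n \<Longrightarrow> C1_curve M \<gamma> (s i) (s (Suc i)) \<and>
        (\<forall>t\<in>{s i..s (Suc i)}. Q (\<gamma> t) (velocity (atlas M) \<gamma> (s i) (s (Suc i)) t))"
      unfolding piecewise_C1_curve_def by blast
    from step(2) obtain \<delta> a' b' where \<delta>: "C1_curve M \<delta> a' b'" "\<delta> a' = y" "\<delta> b' = z"
      "\<forall>t\<in>{a'..b'}. Q (\<delta> t) (velocity (atlas M) \<delta> a' b' t)"
      unfolding C1_path_def by blast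
    have a'b': "a' < b'" using \<delta>(1) unfolding C1_curve_def by blast
    \<comment> \<open>The shift lets the new segment start at parameter \<open>s n\<close>. There
      the two branches agree, since both give \<open>y\<close>.\<close>
    define \<eta> where "\<eta> t = (if t \<le> s n then \<gamma> t else \<delta> (t + (a' - s n)))" for t
    define r where "r i = (if i \<le> n then s i else s n + (b' - a'))" for i
    have mono_step: "s i < s (Suc i)" if "i < n" for i using seg[OF that] unfolding C1_curve_def by blast
    \<comment> \<open>Ensures that all earlier segments fall into the first branch of
      \<eta>.\<close>
    have mono: "s i \<le> s n" if "i \<le> n" for i
      using that by (induction rule: inc_induct) (use mono_step in force)+
    have "C1_curve M \<eta> (r i) (r (Suc i)) \<and>
        (\<forall>t\<in>{r i..r (Suc i)}. Q (\<eta> t) (velocity (atlas M) \<eta> (r i) (r (Suc i)) t))" if "i < Suc n" for i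
    proof (cases "i < n")
      case True
      then have r: "r i = s i" "r (Suc i) = s (Suc i)" by (simp_all add: r_def)
      show ?thesis unfolding r
        using seg[OF True] mono_step[OF True] mono[of "Suc i"] True
        by (intro C1_path_shift[of M \<gamma> "s i" "s (Suc i)" Q _ _ 0]) (auto simp: \<eta>_def)
    next
      case False
      then have r: "r i = s n" "r (Suc i) = s n + (b' - a')" using that by (simp_all add: r_def less_Suc_eq)
      show ?thesis unfolding r
      proof (rule C1_path_shift[OF \<delta>(1,4), where k = "a' - s n"])
        fix t assume t: "t \<in> {s n..s n + (b' - a')}"
        show "\<eta> t = \<delta> (t + (a' - s n))"
          using t s(2) \<delta>(2) by (cases "t = s n") (auto simp: \<eta>_def)
      qed (use a'b' in auto)
    qed
    then have "piecewise_C1_curve M Q \<eta> (r 0) (r (Suc n))"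
      unfolding piecewise_C1_curve_def by blast
    moreover have "\<eta> (r 0) = x" "\<eta> (r (Suc n)) = z"
      using s \<delta> mono[of 0] a'b' by (auto simp: \<eta>_def r_def)
    ultimately show ?case by blast
  qed
qed

lemma chron_less_iff_tranclp: "chron_less M = (C1_path M (future_timelike M))\<^sup>+\<^sup>+"
  using piecewise_C1_curve_iff_tranclp[of M "future_timelike M"]
  by (intro ext) (simp add: chron_less_def timelike_curve_def)

lemma causal_le_iff_tranclp:
  "causal_le M x y \<longleftrightarrow> (x \<in> topspace (pts M) \<and> x = y) \<or> (C1_path M (future_causal M))\<^sup>+\<^sup>+ x y"
  using piecewise_C1_curve_iff_tranclp[of M "future_causal M" x y]
  by (simp add: causal_le_def causal_curve_def)

lemma C1_path_mono:
  assumes "\<And>p v. Q p v \<Longrightarrow> Q' p v" "C1_path M Q x y"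
  shows "C1_path M Q' x y"
  using assms unfolding C1_path_def by blast

lemma C1_path_dense:
  assumes "C1_path M Q x y"
  shows "\<exists>z. C1_path M Q x z \<and> C1_path M Q z y"
proof -
  obtain \<gamma> a b where \<gamma>: "C1_curve M \<gamma> a b" "\<forall>t\<in>{a..b}. Q (\<gamma> t) (velocity (atlas M) \<gamma> a b t)"
    "\<gamma> a = x" "\<gamma> b = y"
    using assms unfolding C1_path_def by blast
  have "a < b" using \<gamma>(1) unfolding C1_curve_def by blast
  then show ?thesis
    using C1_path_restrict[OF \<gamma>(1,2), of a "(a + b) / 2"] C1_path_restrict[OF \<gamma>(1,2), of "(a + b) / 2" b] \<gamma>(3,4)
    by (intro exI[of _ "\<gamma> ((a + b) / 2)"]) simp
qed

lemma C1_path_topspace: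
  assumes "C1_path M Q x y"
  shows "x \<in> topspace (pts M)" "y \<in> topspace (pts M)"
proof -
  obtain \<gamma> a b where \<gamma>: "C1_curve M \<gamma> a b" "\<gamma> a = x" "\<gamma> b = y"
    using assms unfolding C1_path_def by blast
  have cont: "continuous_map (top_of_set {a..b}) (pts M) \<gamma>" and ab: "a < b"
    using \<gamma>(1) unfolding C1_curve_def by blast+
  have "\<gamma> t \<in> topspace (pts M)" if "t \<in> {a..b}" for t
    using continuous_map_image_subset_topspace[OF cont] that by auto
  from this[of a] this[of b] show "x \<in> topspace (pts M)" "y \<in> topspace (pts M)"
    using ab \<gamma>(2,3) by simp_all
qed

text \<open>By continuity the path is already in \<open>U\<close> shortly before its end. It is
  later applied to reversed paths, to find a point of \<open>U\<close> just after a given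
  one.\<close>

lemma C1_path_meets_open:
  assumes "C1_path M Q x y" "openin (pts M) U" "y \<in> U"
  shows "\<exists>z\<in>U. C1_path M Q z y"
proof -
  obtain \<gamma> a b where \<gamma>: "C1_curve M \<gamma> a b" "\<forall>t\<in>{a..b}. Q (\<gamma> t) (velocity (atlas M) \<gamma> a b t)"
    "\<gamma> a = x" "\<gamma> b = y"
    using assms unfolding C1_path_def by blast
  have ab: "a < b" and cont: "continuous_map (top_of_set {a..b}) (pts M) \<gamma>"
    using \<gamma>(1) unfolding C1_curve_def by blast+
  have "b \<in> {t \<in> {a..b}. \<gamma> t \<in> U}" using ab \<gamma>(4) assms(3) by simp
  moreover have "openin (top_of_set {a..b}) {t \<in> {a..b}. \<gamma> t \<in> U}"
    using openin_continuous_map_preimage[OF cont assms(2)] by simp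
  ultimately obtain e where e: "e > 0" "\<And>t. t \<in> {a..b} \<Longrightarrow> dist t b < e \<Longrightarrow> \<gamma> t \<in> U"
    unfolding openin_euclidean_subtopology_iff by blast
  let ?t = "max a (b - e / 2)"
  have "\<gamma> ?t \<in> U" using ab e(1) by (intro e(2)) (auto simp: dist_real_def max_def)
  moreover have "C1_path M Q (\<gamma> ?t) (\<gamma> b)"
    using ab e(1) by (intro C1_path_restrict[OF \<gamma>(1,2)]) auto
  ultimately show ?thesis using \<gamma>(4) by blast
qed

section \<open>Timelike paths in a chart\<close>

context lorentz_spacetime
begin

text \<open>One chart suffices for checking the cone condition; in any other chart the velocity is
  the image of \<open>u'\<close> under the derivative of the transition map, which is again
  continuous.\<close>

lemma C1_path_chart:
  assumes c: "c \<in> \<A>" and ab: "a < b"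
    and der: "\<And>t. t \<in> {a..b} \<Longrightarrow> (u has_vector_derivative u' t) (at t within {a..b})"
    and u': "continuous_on {a..b} u'"
    and cone: "\<And>t. t \<in> {a..b} \<Longrightarrow> (u t, u' t) \<in> future_cone c"
  shows "C1_path M (future_timelike M) (coord_inv c (u a)) (coord_inv c (u b))"
proof -
  let ?\<gamma> = "coord_inv c \<circ> u"
  let ?w = "\<lambda>t. coord_vec \<A> c (?\<gamma> t) (u' t)"
  have dom: "u t \<in> coords c" if "t \<in> {a..b}" for t using cone[OF that] by (simp add: future_cone_def)
  have \<gamma>: "?\<gamma> t \<in> fst c" "snd c (?\<gamma> t) = u t" if "t \<in> {a..b}" for t
    using dom[OF that] coord_inv_in chart_coord_inv by simp_all
  have u: "continuous_on {a..b} u"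
    using der has_vector_derivative_continuous continuous_on_eq_continuous_within by blast
  have 1: "continuous_map (top_of_set {a..b}) X ?\<gamma>"
  proof -
    have "continuous_map (top_of_set {a..b}) (top_of_set (coords c)) u"
      using u dom by auto
    from continuous_map_compose[OF this continuous_map_coord_inv[OF c]] show ?thesis
      by (rule continuous_map_into_fulltopology)
  qed
  have 2: "((snd d \<circ> ?\<gamma>) has_vector_derivative ?w t d) (at t within {a..b})"
    if d: "d \<in> \<A>" and t: "t \<in> {a..b}" and \<gamma>d: "?\<gamma> t \<in> fst d" for d t
  proof -
    have "(transition c d has_derivative frechet_derivative (transition c d) (at (u t))) (at (u t) within u ` {a..b})"
      using has_derivative_transition[OF c d \<gamma>(1)[OF t] \<gamma>d] unfolding \<gamma>(2)[OF t]
      by (rule has_derivative_at_withinI)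
    from vector_derivative_diff_chain_within[OF der[OF t] this]
    show ?thesis using d \<gamma>d \<gamma>(2)[OF t] by (simp add: coord_vec_def charts_at_def transition_def comp_def)
  qed
  have 3: "continuous_on {t \<in> {a..b}. ?\<gamma> t \<in> fst d} (\<lambda>t. ?w t d)" if d: "d \<in> \<A>" for d
  proof -
    let ?S = "{t \<in> {a..b}. ?\<gamma> t \<in> fst d}"
    have "continuous_on ?S (\<lambda>t. frechet_derivative (transition c d) (at (u t)) (u' t))"
    proof (rule continuous_on_linear_family[where w = u' and D = "\<lambda>t. frechet_derivative (transition c d) (at (u t))"])
      show "linear (frechet_derivative (transition c d) (at (u t)))" if "t \<in> ?S" for t
        using linear_transition_derivative[OF c d, of "?\<gamma> t"] \<gamma>[of t] that by simp
      show "continuous_on ?S u'" using u' by (rule continuous_on_subset) auto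
      show "continuous_on ?S (\<lambda>t. frechet_derivative (transition c d) (at (u t)) v)" for v
      proof (rule continuous_on_compose2[OF smooth_on_continuous_derivative[OF smooth_on_transition[OF c d]]])
        show "continuous_on ?S u" using u by (rule continuous_on_subset) auto
        show "u ` ?S \<subseteq> snd c ` (fst c \<inter> fst d)"
        proof
          fix x assume "x \<in> u ` ?S"
          then obtain t where t: "t \<in> {a..b}" "?\<gamma> t \<in> fst d" "x = u t" by blast
          then have "x = snd c (?\<gamma> t)" "?\<gamma> t \<in> fst c \<inter> fst d" using \<gamma>[of t] by auto
          then show "x \<in> snd c ` (fst c \<inter> fst d)" by blast
        qed
      qed
    qed
    then show ?thesis by (rule continuous_on_eq) (use d \<gamma>(2) in \<open>simp add: coord_vec_def charts_at_def\<close>)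
  qed
  have 4: "?w t d = 0" if "d \<notin> charts_at \<A> (?\<gamma> t)" for d t
    using that by (simp add: coord_vec_def)
  have "future_timelike M (?\<gamma> t) (velocity \<A> ?\<gamma> a b t)" if t: "t \<in> {a..b}" for t
  proof -
    have "future_timelike M (?\<gamma> t) (?w t)"
      using future_timelike_coord[OF coord_vec_in_tangent_space[OF c \<gamma>(1)[OF t]] c \<gamma>(1)[OF t]]
        cone[OF t] coord_vec_same[OF c \<gamma>(1)[OF t]] by (simp add: future_cone_def)
    moreover have "velocity \<A> ?\<gamma> a b t = ?w t" by (rule C1_curveI(2)[OF ab 1 2 3 4 t])
    ultimately show ?thesis by (simp only:)
  qed
  moreover have "C1_curve M ?\<gamma> a b" by (rule C1_curveI(1)[OF ab 1 2 3 4])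
  ultimately have "C1_path M (future_timelike M) (?\<gamma> a) (?\<gamma> b)" unfolding C1_path_def by blast
  then show ?thesis by simp
qed

lemma future_cone_ball:
  assumes c: "c \<in> \<A>" and "(x, v) \<in> future_cone c"
  obtains e where "e > 0" "ball x e \<times> ball v e \<subseteq> future_cone c"
proof -
  obtain A B where "open A" "open B" "(x, v) \<in> A \<times> B" and sub: "A \<times> B \<subseteq> future_cone c"
    by (rule open_prod_elim[OF open_future_cone[OF c] assms(2)])
  then have AB: "open A" "open B" "x \<in> A" "v \<in> B" by simp_all
  obtain e1 where "e1 > 0" "ball x e1 \<subseteq> A" using openE[OF AB(1,3)] .
  moreover obtain e2 where "e2 > 0" "ball v e2 \<subseteq> B" using openE[OF AB(2,4)] .
  ultimately have "min e1 e2 > 0" "ball x (min e1 e2) \<times> ball v (min e1 e2) \<subseteq> future_cone c"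
    using sub by (auto simp: subset_iff)
  then show thesis by (rule that)
qed

text \<open>A straight segment stays in the convex ball, and run through in parameter time
  \<open>h\<close> it has the constant velocity \<open>(1 / h) *\<^sub>R (z - y)\<close>. So only
  the average velocity has to be close to \<open>v\<close>.\<close>

lemma C1_path_line:
  assumes c: "c \<in> \<A>" and cone: "ball x e \<times> ball v e \<subseteq> future_cone c"
    and yz: "y \<in> ball x e" "z \<in> ball x e" and h: "h > 0" "(1 / h) *\<^sub>R (z - y) \<in> ball v e"
  shows "C1_path M (future_timelike M) (coord_inv c y) (coord_inv c z)"
proof -
  let ?u = "\<lambda>t. y + t *\<^sub>R (1 / h) *\<^sub>R (z - y)"
  have "C1_path M (future_timelike M) (coord_inv c (?u 0)) (coord_inv c (?u h))"
  proof (rule C1_path_chart[OF c h(1)])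
    show "(?u has_vector_derivative (1 / h) *\<^sub>R (z - y)) (at t within {0..h})" for t
      using h(1) by (auto intro!: derivative_eq_intros simp: has_vector_derivative_def)
    fix t assume t: "t \<in> {0..h}"
    have "?u t = (1 - t / h) *\<^sub>R y + (t / h) *\<^sub>R z" by (simp add: algebra_simps)
    also have "\<dots> \<in> ball x e"
      using t h(1) by (intro convexD[OF convex_ball yz]) (auto simp: field_simps)
    finally show "(?u t, (1 / h) *\<^sub>R (z - y)) \<in> future_cone c" using cone h(2) by blast
  qed simp
  then show ?thesis using h(1) by simp
qed

lemma chronological_future_nonempty:
  assumes "p \<in> topspace X"
  shows "\<exists>q. C1_path M (future_timelike M) p q"
proof -
  obtain c where c: "c \<in> \<A>" "p \<in> fst c" using chart_cover assms by blast
  let ?x = "snd c p" and ?v = "orient_coord c (snd c p)"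
  have "(?x, ?v) \<in> future_cone c" using orient_in_future_cone c by blast
  then obtain e where e: "e > 0" "ball ?x e \<times> ball ?v e \<subseteq> future_cone c"
    using future_cone_ball[OF c(1)] by blast
  \<comment> \<open>The added 1 makes the displacement strictly shorter than
    \<open>e\<close>.\<close>
  define h where "h = e / (norm ?v + 1)"
  have np: "norm ?v + 1 > 0" using norm_ge_zero[of ?v] by linarith
  have h: "h > 0" using e(1) np by (simp add: h_def)
  have "norm (h *\<^sub>R ?v) < h * (norm ?v + 1)" using h by simp
  also have "\<dots> = e" using np by (simp add: h_def)
  finally have "?x + h *\<^sub>R ?v \<in> ball ?x e" by (simp add: dist_norm)
  then have "C1_path M (future_timelike M) (coord_inv c ?x) (coord_inv c (?x + h *\<^sub>R ?v))"
    using e(1) h by (intro C1_path_line[OF c(1) e(2) _ _ h]) simp_all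
  then show ?thesis using c by auto
qed

text \<open>Only the last bit of the path lies in a chart around \<open>q\<close>, so the path is
  cut at a point \<open>p'\<close> shortly before \<open>q\<close>. The average velocity from there
  to \<open>q\<close> is close to the final velocity, and remains so when \<open>q\<close> is moved
  a little.\<close>

lemma C1_path_open:
  assumes "C1_path M (future_timelike M) p q"
  shows "\<exists>p' U. C1_path M (future_timelike M) p p' \<and> openin X U \<and> q \<in> U \<and>
    (\<forall>z\<in>U. C1_path M (future_timelike M) p' z)"
proof -
  obtain \<gamma> a b where \<gamma>: "C1_curve M \<gamma> a b"
    "\<forall>t\<in>{a..b}. future_timelike M (\<gamma> t) (velocity \<A> \<gamma> a b t)" "\<gamma> a = p" "\<gamma> b = q"
    using assms unfolding C1_path_def by blast
  have ab: "a < b" and cont: "continuous_map (top_of_set {a..b}) X \<gamma>"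
    using \<gamma>(1) unfolding C1_curve_def by blast+
  have b: "b \<in> {a..b}" using ab by simp
  obtain c where c: "c \<in> \<A>" "q \<in> fst c" using chart_cover C1_path_topspace(2)[OF assms] by blast
  define v where "v = velocity \<A> \<gamma> a b b c"
  let ?u = "snd c \<circ> \<gamma>"
  have ft: "future_timelike M q (velocity \<A> \<gamma> a b b)" using \<gamma>(2,4) b by blast
  then have "velocity \<A> \<gamma> a b b \<in> tangent_space \<A> q"
    using future_timelike_imp_causal future_causal_tangent by blast
  from future_timelike_coord[OF this c] ft have "(snd c q, v) \<in> future_cone c"
    using c by (simp add: future_cone_def v_def)
  then obtain e where e: "e > 0" "ball (snd c q) e \<times> ball v e \<subseteq> future_cone c"
    using future_cone_ball[OF c(1)] by blast
  have "(?u has_vector_derivative v) (at b within {a..b})"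
    unfolding v_def using \<gamma> b c by (intro C1_curve_has_vector_derivative) auto
  \<comment> \<open>A quarter of \<open>e\<close> is spent on the linear approximation at the end,
    another quarter later on moving the end point; together they stay below
    \<open>e\<close>.\<close>
  then obtain d1 where d1: "d1 > 0" "\<And>t. t \<in> {a..b} \<Longrightarrow> norm (t - b) < d1 \<Longrightarrow>
      norm (?u t - ?u b - (t - b) *\<^sub>R v) \<le> e / 4 * norm (t - b)"
    using e(1) unfolding has_vector_derivative_def has_derivative_within_alt
    by (metis divide_pos_pos zero_less_numeral)
  have "b \<in> {t \<in> {a..b}. \<gamma> t \<in> fst c}" using b \<gamma>(4) c(2) by simp
  moreover have "openin (top_of_set {a..b}) {t \<in> {a..b}. \<gamma> t \<in> fst c}"
    using openin_continuous_map_preimage[OF cont openin_chart[OF c(1)]] by simp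
  ultimately obtain d2 where d2: "d2 > 0" "\<And>t. t \<in> {a..b} \<Longrightarrow> dist t b < d2 \<Longrightarrow> \<gamma> t \<in> fst c"
    unfolding openin_euclidean_subtopology_iff by blast
  define N where "N = e / 4 + norm v + 1"
  have N: "N > 0" using e(1) by (simp add: N_def add_pos_nonneg add_nonneg_pos)
  \<comment> \<open>In turn: the linear approximation holds at \<open>b - \<delta>\<close>, the
    point there lies in the chart, the parameter lies in the interval, and, since \<open>N\<close>
    bounds the average speed, the position lies in the ball of radius \<open>e\<close>.\<close>
  define \<delta> where "\<delta> = min (min (d1 / 2) (d2 / 2)) (min ((b - a) / 2) (e / (2 * N)))"
  have \<delta>: "\<delta> > 0" "\<delta> < d1" "\<delta> < d2" "\<delta> < b - a" "\<delta> * N < e"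
  proof -
    have "\<delta> \<le> d1 / 2" "\<delta> \<le> d2 / 2" "\<delta> \<le> (b - a) / 2" unfolding \<delta>_def by linarith+
    moreover have "(b - a) / 2 < b - a" using ab by (simp add: field_simps)
    ultimately show "\<delta> < d1" "\<delta> < d2" "\<delta> < b - a" using d1(1) d2(1) by simp_all
    show "\<delta> > 0" using d1(1) d2(1) ab e(1) N by (simp add: \<delta>_def)
    have "\<delta> * N \<le> e / (2 * N) * N" using N by (intro mult_right_mono) (auto simp: \<delta>_def)
    also have "\<dots> < e" using N e(1) by simp
    finally show "\<delta> * N < e" .
  qed
  define t where "t = b - \<delta>"
  have t: "t \<in> {a..b}" "a < t" "t < b" "b - t = \<delta>" using \<delta> by (auto simp: t_def)
  have ub: "?u b = snd c q" using \<gamma>(4) by simp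
  have near: "norm (snd c q - ?u t - \<delta> *\<^sub>R v) \<le> e / 4 * \<delta>"
  proof -
    have "norm (?u t - snd c q + \<delta> *\<^sub>R v) \<le> e / 4 * \<delta>"
      using d1(2)[OF t(1)] \<delta>(1,2) unfolding ub by (simp add: t_def)
    moreover have "snd c q - ?u t - \<delta> *\<^sub>R v = - (?u t - snd c q + \<delta> *\<^sub>R v)" by simp
    ultimately show ?thesis by (metis norm_minus_cancel)
  qed
  have "norm (snd c q - ?u t) \<le> norm (snd c q - ?u t - \<delta> *\<^sub>R v) + norm (\<delta> *\<^sub>R v)"
    using norm_triangle_ineq[of "snd c q - ?u t - \<delta> *\<^sub>R v" "\<delta> *\<^sub>R v"] by simp
  also have "\<dots> \<le> \<delta> * N" using near \<delta>(1) by (simp add: N_def algebra_simps)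
  finally have ut: "?u t \<in> ball (snd c q) e" using \<delta>(5) by (simp add: dist_norm)
  have \<gamma>t: "\<gamma> t \<in> fst c" using d2(2)[OF t(1)] \<delta> by (simp add: t_def dist_real_def)
  \<comment> \<open>The bound \<open>e\<close> keeps targets over the cone neighbourhood;
    \<open>e / 4 * \<delta>\<close> costs at most \<open>e / 4\<close> after division by
    \<delta>.\<close>
  define \<rho> where "\<rho> = min e (e / 4 * \<delta>)"
  have \<rho>: "\<rho> > 0" using e(1) \<delta>(1) by (simp add: \<rho>_def)
  let ?U = "coord_inv c ` ball (snd c q) \<rho>"
  have "ball (snd c q) \<rho> \<subseteq> coords c"
  proof
    fix z assume "z \<in> ball (snd c q) \<rho>"
    then have "(z, v) \<in> future_cone c" using e by (intro subsetD[OF e(2)]) (simp add: \<rho>_def)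
    then show "z \<in> coords c" by (simp add: future_cone_def)
  qed
  then have "openin X ?U" using openin_coord_inv_image[OF c(1)] by blast
  moreover have "q \<in> ?U"
    using \<rho> c by (intro image_eqI[of _ _ "snd c q"]) simp_all
  moreover have "C1_path M (future_timelike M) p (\<gamma> t)"
    using C1_path_restrict[OF \<gamma>(1,2), of a t] t \<gamma>(3) by simp
  moreover have "C1_path M (future_timelike M) (\<gamma> t) (coord_inv c z)" if z: "z \<in> ball (snd c q) \<rho>" for z
  proof -
    have "norm ((1 / \<delta>) *\<^sub>R (z - ?u t) - v) = norm ((1 / \<delta>) *\<^sub>R (z - ?u t - \<delta> *\<^sub>R v))"
      using \<delta>(1) by (simp add: algebra_simps)
    also have "\<dots> = norm (z - ?u t - \<delta> *\<^sub>R v) / \<delta>" using \<delta>(1) by simp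
    also have "z - ?u t - \<delta> *\<^sub>R v = (z - snd c q) + (snd c q - ?u t - \<delta> *\<^sub>R v)" by simp
    also have "norm \<dots> / \<delta> \<le> (\<rho> + e / 4 * \<delta>) / \<delta>"
      using z near \<delta>(1)
      by (intro divide_right_mono norm_triangle_le add_mono) (simp_all add: dist_norm norm_minus_commute)
    also have "\<dots> \<le> (e / 4 * \<delta> + e / 4 * \<delta>) / \<delta>"
      unfolding \<rho>_def using \<delta>(1) by (intro divide_right_mono add_mono min.cobounded2) simp_all
    also have "\<dots> < e" using \<delta>(1) e(1) by (simp add: field_simps)
    finally have "(1 / \<delta>) *\<^sub>R (z - ?u t) \<in> ball v e" by (simp add: dist_norm norm_minus_commute)
    then have "C1_path M (future_timelike M) (coord_inv c (?u t)) (coord_inv c z)"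
      using z by (intro C1_path_line[OF c(1) e(2) ut _ \<delta>(1)]) (simp_all add: \<rho>_def)
    then show ?thesis using c \<gamma>t by simp
  qed
  ultimately show ?thesis by blast
qed

text \<open>The mean value theorem for each matrix entry along the segment, with the derivative in
  direction \<open>T\<close> bounded by compactness of the closed ball. The bound is linear in
  \<sigma>; this lets the metric error be compared with a gain of the same order.\<close>

lemma metric_lipschitz_along:
  assumes c: "c \<in> \<A>" and r: "cball x0 r \<subseteq> coords c"
  obtains C where "C \<ge> 0"
    "\<And>x \<sigma> a b. \<lbrakk>\<sigma> \<ge> 0; x \<in> cball x0 r; x - \<sigma> *\<^sub>R T \<in> cball x0 r\<rbrakk> \<Longrightarrow>
       \<bar>G c (x - \<sigma> *\<^sub>R T) a b - G c x a b\<bar> \<le> C * \<sigma> * norm a * norm b"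
proof -
  let ?D = "\<lambda>i j x. frechet_derivative (\<lambda>x. G c x i j) (at x) T"
  have "\<exists>L\<ge>0. \<forall>x\<in>cball x0 r. \<bar>?D i j x\<bar> \<le> L" for i j
  proof -
    have "continuous_on (cball x0 r) (?D i j)"
      using smooth_on_continuous_derivative[OF smooth_on_G[OF c]] r by (rule continuous_on_subset)
    then have "bounded (?D i j ` cball x0 r)"
      by (intro compact_imp_bounded compact_continuous_image compact_cball)
    then obtain L where "\<forall>y\<in>?D i j ` cball x0 r. \<bar>y\<bar> \<le> L" unfolding bounded_real by blast
    then show ?thesis by (intro exI[of _ "max 0 L"]) (auto simp: max.coboundedI2)
  qed
  then obtain L where L: "\<And>i j. L i j \<ge> 0" "\<And>i j x. x \<in> cball x0 r \<Longrightarrow> \<bar>?D i j x\<bar> \<le> L i j"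
    by metis
  \<comment> \<open>Components of \<open>a\<close> and \<open>b\<close> are bounded by their norms,
    so the entrywise constants simply add up.\<close>
  define C where "C = (\<Sum>i\<in>Basis. \<Sum>j\<in>Basis. L i j)"
  show thesis
  proof (rule that)
    show "C \<ge> 0" by (simp add: C_def L(1) sum_nonneg)
    fix x a b and \<sigma> :: real
    assume \<sigma>: "\<sigma> \<ge> 0" and x: "x \<in> cball x0 r" "x - \<sigma> *\<^sub>R T \<in> cball x0 r"
    have entry: "\<bar>G c (x - \<sigma> *\<^sub>R T) i j - G c x i j\<bar> \<le> L i j * \<sigma>" for i j
    proof -
      have seg: "x - s *\<^sub>R T \<in> cball x0 r" if "0 \<le> s" "s \<le> \<sigma>" for s
      proof (cases "\<sigma> = 0")
        case False
        then have "x - s *\<^sub>R T = (1 - s / \<sigma>) *\<^sub>R x + (s / \<sigma>) *\<^sub>R (x - \<sigma> *\<^sub>R T)"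
          by (simp add: algebra_simps)
        also have "\<dots> \<in> cball x0 r"
          using that \<sigma> False by (intro convexD[OF convex_cball x]) (auto simp: field_simps)
        finally show ?thesis .
      qed (use that x in auto)
      have der: "((\<lambda>s. G c (x - s *\<^sub>R T) i j) has_derivative (\<lambda>h. h * - ?D i j (x - s *\<^sub>R T))) (at s within {0..\<sigma>})"
        if "0 \<le> s" "s \<le> \<sigma>" for s
      proof -
        let ?F = "frechet_derivative (\<lambda>x. G c x i j) (at (x - s *\<^sub>R T))"
        have "x - s *\<^sub>R T \<in> coords c" using seg[OF that] r by blast
        then have F: "((\<lambda>x. G c x i j) has_derivative ?F) (at (x - s *\<^sub>R T))"
          using smooth_on_differentiable[OF smooth_on_G[OF c]] frechet_derivative_works by blast
        have "((\<lambda>s. x - s *\<^sub>R T) has_derivative (\<lambda>h. h *\<^sub>R (- T))) (at s within {0..\<sigma>})"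
          by (auto intro!: derivative_eq_intros)
        from has_derivative_compose[OF this F]
        show ?thesis using linear_cmul[OF has_derivative_linear[OF F]] linear_neg[OF has_derivative_linear[OF F]] by simp
      qed
      from mvt_very_simple[OF \<sigma> der] obtain s where s: "s \<in> {0..\<sigma>}"
        "G c (x - \<sigma> *\<^sub>R T) i j - G c x i j = \<sigma> * - ?D i j (x - s *\<^sub>R T)" by auto
      then have "\<bar>G c (x - \<sigma> *\<^sub>R T) i j - G c x i j\<bar> = \<sigma> * \<bar>?D i j (x - s *\<^sub>R T)\<bar>"
        using \<sigma> by (simp add: abs_mult)
      also have "\<dots> \<le> \<sigma> * L i j" using L(2)[OF seg] s(1) \<sigma> by (intro mult_left_mono) auto
      finally show ?thesis by (simp add: mult.commute)
    qed
    have expand: "G c y a b = (\<Sum>i\<in>Basis. \<Sum>j\<in>Basis. (a \<bullet> i) * (b \<bullet> j) * G c y i j)" if "y \<in> cball x0 r" for y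
    proof -
      have bil: "bilinear (G c y)" using bilinear_coord[OF c coord_inv_in] that r by blast
      have "G c y a b = G c y (\<Sum>i\<in>Basis. (a \<bullet> i) *\<^sub>R i) (\<Sum>j\<in>Basis. (b \<bullet> j) *\<^sub>R j)"
        by (simp only: euclidean_representation)
      then show ?thesis
        by (simp add: bilinear_sum[OF bil] bilinear_lmul[OF bil] bilinear_rmul[OF bil]
            sum.cartesian_product mult_ac split: prod.splits)
    qed
    have "\<bar>G c (x - \<sigma> *\<^sub>R T) a b - G c x a b\<bar> =
        \<bar>\<Sum>i\<in>Basis. \<Sum>j\<in>Basis. (a \<bullet> i) * (b \<bullet> j) * (G c (x - \<sigma> *\<^sub>R T) i j - G c x i j)\<bar>"
      unfolding expand[OF x(1)] expand[OF x(2)] by (simp add: sum_subtractf right_diff_distrib)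
    also have "\<dots> \<le> (\<Sum>i\<in>Basis. \<Sum>j\<in>Basis. norm a * norm b * (L i j * \<sigma>))"
    proof (intro order_trans[OF sum_abs] sum_mono)
      fix i j :: 'e assume ij: "i \<in> Basis" "j \<in> Basis"
      show "\<bar>(a \<bullet> i) * (b \<bullet> j) * (G c (x - \<sigma> *\<^sub>R T) i j - G c x i j)\<bar> \<le> norm a * norm b * (L i j * \<sigma>)"
        unfolding abs_mult using ij entry Basis_le_norm
        by (intro mult_mono) auto
    qed
    also have "\<dots> = C * \<sigma> * norm a * norm b"
      by (simp add: C_def sum_distrib_left sum_distrib_right mult_ac)
    finally show "\<bar>G c (x - \<sigma> *\<^sub>R T) a b - G c x a b\<bar> \<le> C * \<sigma> * norm a * norm b" .
  qed
qed

section \<open>Pushing up causal curves\<close>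

text \<open>Pushing the causal curve \<open>u\<close> down to \<open>u \<tau> - \<epsilon> (t - \<tau>) T\<close> adds \<open>\<epsilon> T\<close> to its velocity, which
  gains a timelike term of order \<open>\<epsilon>\<close>, while moving the base point changes the metric by at most
  \<open>C \<epsilon> (t - \<tau>)\<close>. On a short parameter interval the gain wins.\<close>

lemma causal_push_up_local:
  assumes \<gamma>: "C1_curve M \<gamma> a b"
    and causal: "\<And>t. t \<in> {a..b} \<Longrightarrow> future_causal M (\<gamma> t) (velocity \<A> \<gamma> a b t)"
    and \<tau>0: "\<tau>0 \<in> {a..b}"
    and W: "openin X W" and up: "\<And>x y. x \<in> W \<Longrightarrow> C1_path M (future_timelike M) x y \<Longrightarrow> y \<in> W"
  shows "\<exists>d>0. \<forall>s t. a \<le> s \<and> s \<le> \<tau>0 \<and> \<tau>0 \<le> t \<and> t \<le> b \<and> t - s < d \<and> \<gamma> s \<in> W \<longrightarrow> \<gamma> t \<in> W"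
proof -
  have cont: "continuous_map (top_of_set {a..b}) X \<gamma>"
    using \<gamma> unfolding C1_curve_def by blast
  have "\<gamma> \<tau>0 \<in> topspace X"
    using continuous_map_image_subset_topspace[OF cont] \<tau>0 by auto
  then obtain c where c: "c \<in> \<A>" "\<gamma> \<tau>0 \<in> fst c" using chart_cover by blast
  define u where "u = snd c \<circ> \<gamma>"
  define u' where "u' t = velocity \<A> \<gamma> a b t c" for t
  define x0 where "x0 = u \<tau>0"
  \<comment> \<open>The orientation field is only continuous. Freezing its value at
    \<open>x0\<close> as a constant coordinate vector makes the deformed curve differentiable, with
    an explicit derivative.\<close>
  define T where "T = orient_coord c x0"
  have x0: "x0 \<in> coords c" "coord_inv c x0 = \<gamma> \<tau>0" using c by (simp_all add: x0_def u_def)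
  obtain e where e: "e > 0" "ball x0 e \<times> ball T e \<subseteq> future_cone c"
    using future_cone_ball[OF c(1) orient_in_future_cone[OF c(1) x0(1)]] unfolding T_def by blast
  define r where "r = e / 2"
  have r: "r > 0" using e(1) by (simp add: r_def)
  have coneT: "(x, T) \<in> future_cone c" if "x \<in> cball x0 r" for x
  proof (rule subsetD[OF e(2)])
    show "(x, T) \<in> ball x0 e \<times> ball T e" using that e(1) by (simp add: r_def)
  qed
  then have K: "cball x0 r \<subseteq> coords c" by (auto simp: future_cone_def)
  obtain C where C: "C \<ge> 0" "\<And>x \<sigma> a b. \<lbrakk>\<sigma> \<ge> 0; x \<in> cball x0 r; x - \<sigma> *\<^sub>R T \<in> cball x0 r\<rbrakk> \<Longrightarrow>
       \<bar>G c (x - \<sigma> *\<^sub>R T) a b - G c x a b\<bar> \<le> C * \<sigma> * norm a * norm b"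
    using metric_lipschitz_along[OF c(1) K] by blast
  define N where "N = {t \<in> {a..b}. \<gamma> t \<in> fst c}"
  have openN: "openin (top_of_set {a..b}) N"
    using openin_continuous_map_preimage[OF cont openin_chart[OF c(1)]] by (simp add: N_def)
  have inv: "coord_inv c (u t) = \<gamma> t" "u t \<in> coords c" if "t \<in> N" for t
    using that c by (simp_all add: u_def N_def)
  have der: "(u has_vector_derivative u' t) (at t within {a..b})" if "t \<in> N" for t
    unfolding u_def u'_def using that
    by (intro C1_curve_has_vector_derivative[OF \<gamma> c(1)]) (simp_all add: N_def)
  have u'cont: "continuous_on N u'"
    using \<gamma> c(1) unfolding C1_curve_def N_def u'_def by blast
  have ucont: "continuous_on N u"
  proof (rule continuous_on_vector_derivative)
    show "(u has_vector_derivative u' t) (at t within N)" if "t \<in> N" for t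
      using der[OF that] by (rule has_vector_derivative_within_subset) (auto simp: N_def)
  qed
  have vel: "G c (u t) (u' t) (u' t) \<le> 0" "G c (u t) (u' t) (orient_coord c (u t)) < 0" if "t \<in> N" for t
  proof -
    have t: "t \<in> {a..b}" "\<gamma> t \<in> fst c" using that by (simp_all add: N_def)
    from future_causal_coord[OF future_causal_tangent[OF causal[OF t(1)]] c(1) t(2)] causal[OF t(1)]
    show "G c (u t) (u' t) (u' t) \<le> 0" "G c (u t) (u' t) (orient_coord c (u t)) < 0"
      unfolding inv(1)[OF that] u'_def by blast+
  qed
  have \<tau>0N: "\<tau>0 \<in> N" using \<tau>0 c by (simp add: N_def)
  \<comment> \<open>Half of the positive number \<open>- G c x0 (u' \<tau>0) T\<close>; the other
    half is room for continuity, so that the product stays below \<open>- m\<close> near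
    \<tau>0.\<close>
  define m where "m = - G c x0 (u' \<tau>0) T / 2"
  have m: "m > 0" using vel(2)[OF \<tau>0N] by (simp add: m_def T_def x0_def)
  define A where "A = norm (u' \<tau>0) + 1"
  have A: "A > 0" by (simp add: A_def add_nonneg_pos)
  let ?f = "\<lambda>t. (u t, norm (u' t), G c (u t) (u' t) T)"
  let ?O = "ball x0 (r / 2) \<times> {..<A} \<times> {..<- m}"
  have "continuous_on N ?f"
    using inv(2) by (intro continuous_intros continuous_on_G[OF c(1)] ucont u'cont) auto
  moreover have "open ?O" by (intro open_Times) auto
  ultimately have "openin (top_of_set N) (N \<inter> ?f -` ?O)"
    by (rule continuous_openin_preimage_gen)
  then have "openin (top_of_set {a..b}) (N \<inter> ?f -` ?O)" using openN openin_trans by blast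
  moreover have "\<tau>0 \<in> N \<inter> ?f -` ?O"
    using \<tau>0N r m by (simp add: A_def m_def flip: x0_def)
  ultimately obtain d0 where d0: "d0 > 0" "\<And>t. t \<in> {a..b} \<Longrightarrow> dist t \<tau>0 < d0 \<Longrightarrow> t \<in> N \<inter> ?f -` ?O"
    unfolding openin_euclidean_subtopology_iff by blast
  \<comment> \<open>\<open>d0\<close> keeps all of \<open>{s..t}\<close> where the local bounds
    hold; the second term gives \<open>short\<close>, with the added 1 covering
    \<open>C = 0\<close>. Neither depends on \<open>s\<close>, \<open>t\<close> or \<open>W\<close>,
    as bisection requires.\<close>
  define d where "d = min d0 (m / (2 * (C * A\<^sup>2 + 1)))"
  have CA: "C * A\<^sup>2 + 1 > 0" using C(1) by (simp add: add_nonneg_pos)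
  have d: "d > 0" using d0(1) m CA by (simp add: d_def)
  have "\<gamma> t \<in> W" if st: "a \<le> s" "s \<le> \<tau>0" "\<tau>0 \<le> t" "t \<le> b" "t - s < d" "\<gamma> s \<in> W" for s t
  proof (cases "s = t")
    case False
    then have s_t: "s < t" using st by simp
    have loc: "\<tau> \<in> N" "u \<tau> \<in> ball x0 (r / 2)" "norm (u' \<tau>) < A" "G c (u \<tau>) (u' \<tau>) T < - m"
      if "\<tau> \<in> {s..t}" for \<tau>
    proof -
      have "\<tau> \<in> {a..b}" "dist \<tau> \<tau>0 < d0"
        using that st by (auto simp: dist_real_def d_def)
      from d0(2)[OF this] show "\<tau> \<in> N" "u \<tau> \<in> ball x0 (r / 2)" "norm (u' \<tau>) < A" "G c (u \<tau>) (u' \<tau>) T < - m"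
        by auto
    qed
    have short: "C * (t - s) * A\<^sup>2 \<le> m / 2"
    proof -
      have "C * (t - s) * A\<^sup>2 \<le> (t - s) * (C * A\<^sup>2 + 1)" using s_t by (simp add: algebra_simps)
      also have "\<dots> \<le> m / (2 * (C * A\<^sup>2 + 1)) * (C * A\<^sup>2 + 1)"
        using st(5) CA by (intro mult_right_mono) (auto simp: d_def)
      also have "\<dots> = m / 2"
      proof -
        have "m / (2 * k) * k = m / 2" if "k > 0" for k using that by simp
        then show ?thesis using CA by blast
      qed
      finally show ?thesis .
    qed
    have sN: "s \<in> N" "t \<in> N" using loc s_t by auto
    have "open (snd c ` (fst c \<inter> W))" by (rule open_chart_image[OF c(1) W])
    moreover have "u s \<in> snd c ` (fst c \<inter> W)" using sN(1) st(6) by (simp add: u_def N_def)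
    ultimately obtain \<rho> where \<rho>: "\<rho> > 0" "ball (u s) \<rho> \<subseteq> snd c ` (fst c \<inter> W)"
      by (rule openE)
    define L where "L = (t - s) * norm T"
    have L: "L \<ge> 0" using s_t by (simp add: L_def)
    define Q where "Q = L + C * L * A + 1"
    have CLA: "C * L * A \<ge> 0" using C(1) L A by simp
    have Q: "Q > 0" "L \<le> Q" "C * L * A \<le> Q" using L CLA by (simp_all add: Q_def)
    \<comment> \<open>The three bounds keep the deformed curve in the closed ball, keep its start in
      \<open>W\<close>, and limit the change of the product of \<open>u'\<close> with
      \<open>T\<close> to \<open>m / 2\<close>. Since \<open>Q\<close> dominates \<open>L\<close>
      and \<open>C * L * A\<close>, the choice \<open>\<epsilon> = \<kappa> / Q\<close> meets all
      three.\<close>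
    define \<kappa> where "\<kappa> = min (r / 2) (min (\<rho> / 2) (m / 2))"
    have \<kappa>: "\<kappa> > 0" "\<kappa> \<le> r / 2" "\<kappa> < \<rho>" "\<kappa> \<le> m / 2"
    proof -
      have "\<kappa> \<le> \<rho> / 2" unfolding \<kappa>_def by linarith
      then show "\<kappa> < \<rho>" using \<rho>(1) by linarith
    qed (use r \<rho>(1) m in \<open>auto simp: \<kappa>_def\<close>)
    define \<epsilon> where "\<epsilon> = \<kappa> / Q"
    have \<epsilon>: "\<epsilon> > 0" "\<epsilon> * Q = \<kappa>" using Q(1) \<kappa>(1) by (simp_all add: \<epsilon>_def)
    have \<epsilon>L: "\<epsilon> * L \<le> \<kappa>" "\<epsilon> * (C * L * A) \<le> \<kappa>"
      using mult_left_mono[OF Q(2), of \<epsilon>] mult_left_mono[OF Q(3), of \<epsilon>] \<epsilon> by simp_all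
    \<comment> \<open>The shift vanishes at \<open>t\<close>, so the end is still
      \<open>\<gamma> t\<close>; at \<open>s\<close> it has length \<open>\<epsilon> * L\<close>,
      which is less than \<rho>.\<close>
    define w where "w \<tau> = u \<tau> - (\<epsilon> * (t - \<tau>)) *\<^sub>R T" for \<tau>
    define w' where "w' \<tau> = u' \<tau> + \<epsilon> *\<^sub>R T" for \<tau>
    have cone: "(w \<tau>, w' \<tau>) \<in> future_cone c" if \<tau>: "\<tau> \<in> {s..t}" for \<tau>
    proof -
      define \<sigma> where "\<sigma> = \<epsilon> * (t - \<tau>)"
      have \<sigma>: "\<sigma> \<ge> 0" "\<sigma> \<le> \<epsilon> * (t - s)" using \<tau> \<epsilon>(1) by (simp_all add: \<sigma>_def mult_left_mono)
      have "norm (\<sigma> *\<^sub>R T) \<le> \<epsilon> * (t - s) * norm T" using \<sigma> by (simp add: mult_right_mono)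
      also have "\<dots> \<le> r / 2" using \<epsilon>L(1) \<kappa>(2) by (simp add: L_def mult.assoc)
      finally have \<sigma>T: "norm (\<sigma> *\<^sub>R T) \<le> r / 2" .
      have "dist x0 (w \<tau>) \<le> dist x0 (u \<tau>) + dist (u \<tau>) (w \<tau>)" by (rule dist_triangle)
      then have wK: "w \<tau> \<in> cball x0 r"
        using loc(2)[OF \<tau>] \<sigma>T by (simp add: w_def dist_norm flip: \<sigma>_def)
      have uK: "u \<tau> \<in> cball x0 r" using loc(2)[OF \<tau>] r by simp
      have w\<sigma>: "w \<tau> = u \<tau> - \<sigma> *\<^sub>R T" by (simp add: w_def \<sigma>_def)
      have lip: "G c (w \<tau>) p q \<le> G c (u \<tau>) p q + C * \<sigma> * norm p * norm q" for p q
        using C(2)[OF \<sigma>(1) uK wK[unfolded w\<sigma>], of p q] unfolding w\<sigma> by linarith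
      have wT: "G c (w \<tau>) T T < 0" "G c (w \<tau>) T (orient_coord c (w \<tau>)) < 0" and wdom: "w \<tau> \<in> coords c"
        using coneT[OF wK] by (simp_all add: future_cone_def)
      have lor: "lorentz_form (G c (w \<tau>))"
        using lorentz_form_coord[OF c(1) coord_inv_in[OF wdom]] .
      then have bil: "bilinear (G c (w \<tau>))" and sym: "\<And>p q. G c (w \<tau>) p q = G c (w \<tau>) q p"
        unfolding lorentz_form_def by blast+
      have nu': "norm (u' \<tau>) \<le> A" using loc(3)[OF \<tau>] by simp
      have "G c (w \<tau>) (u' \<tau>) (u' \<tau>) \<le> C * \<sigma> * norm (u' \<tau>) * norm (u' \<tau>)"
        using lip[of "u' \<tau>" "u' \<tau>"] vel(1)[OF loc(1)[OF \<tau>]] by linarith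
      also have "\<dots> \<le> C * (\<epsilon> * (t - s)) * A * A"
        using \<sigma> C(1) nu' A \<epsilon>(1) s_t by (intro mult_mono mult_left_mono mult_nonneg_nonneg) auto
      also have "\<dots> = \<epsilon> * (C * (t - s) * A\<^sup>2)" by (simp add: power2_eq_square)
      also have "\<dots> \<le> \<epsilon> * (m / 2)" using short \<epsilon>(1) by (intro mult_left_mono) auto
      finally have g1: "G c (w \<tau>) (u' \<tau>) (u' \<tau>) \<le> \<epsilon> * (m / 2)" .
      have "C * \<sigma> * norm (u' \<tau>) * norm T \<le> C * (\<epsilon> * (t - s)) * A * norm T"
        using \<sigma> C(1) nu' A \<epsilon>(1) s_t by (intro mult_mono mult_left_mono mult_nonneg_nonneg) auto
      also have "\<dots> = \<epsilon> * (C * L * A)" by (simp add: L_def)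
      also have "\<dots> \<le> m / 2" using \<epsilon>L(2) \<kappa>(4) by linarith
      finally have g2: "G c (w \<tau>) (u' \<tau>) T \<le> - (m / 2)"
        using lip[of "u' \<tau>" T] loc(4)[OF \<tau>] by linarith
      have "G c (w \<tau>) (w' \<tau>) (w' \<tau>) =
          G c (w \<tau>) (u' \<tau>) (u' \<tau>) + 2 * \<epsilon> * G c (w \<tau>) (u' \<tau>) T + \<epsilon>\<^sup>2 * G c (w \<tau>) T T"
        using sym[of T "u' \<tau>"]
        by (simp add: w'_def bilinear_ladd[OF bil] bilinear_radd[OF bil] bilinear_lmul[OF bil]
            bilinear_rmul[OF bil] power2_eq_square algebra_simps)
      \<comment> \<open>The metric error costs at most \<open>\<epsilon> * (m / 2)\<close>, the
        cross term gains at least \<open>\<epsilon> * m\<close>, and the quadratic term is negative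
        because \<open>T\<close> is timelike.\<close>
      also have "\<dots> < \<epsilon> * (m / 2) + 2 * \<epsilon> * - (m / 2) + 0"
        using g1 g2 \<epsilon>(1) wT(1)
        by (intro add_le_less_mono add_mono mult_left_mono mult_pos_neg) auto
      also have "\<dots> \<le> 0" using \<epsilon>(1) m by simp
      finally have ww: "G c (w \<tau>) (w' \<tau>) (w' \<tau>) < 0" .
      have "G c (w \<tau>) (w' \<tau>) T = G c (w \<tau>) (u' \<tau>) T + \<epsilon> * G c (w \<tau>) T T"
        by (simp add: w'_def bilinear_ladd[OF bil] bilinear_lmul[OF bil])
      also have "\<dots> < 0" using g2 m mult_pos_neg[OF \<epsilon>(1) wT(1)] by linarith
      finally have wT': "G c (w \<tau>) (w' \<tau>) T < 0" .
      have "w' \<tau> \<noteq> 0" using ww bilinear_lzero[OF bil] by force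
      then have "G c (w \<tau>) (w' \<tau>) (orient_coord c (w \<tau>)) < 0"
        using lorentz_form_same_cone[OF lor orient_timelike[OF c(1) coord_inv_in[OF wdom]] wT(1,2), of "w' \<tau>"]
          ww wT' by simp
      with ww wdom show ?thesis by (simp add: future_cone_def)
    qed
    have "C1_path M (future_timelike M) (coord_inv c (w s)) (coord_inv c (w t))"
    proof (rule C1_path_chart[OF c(1) s_t _ _ cone])
      show "(w has_vector_derivative w' \<tau>) (at \<tau> within {s..t})" if \<tau>: "\<tau> \<in> {s..t}" for \<tau>
      proof -
        have "(u has_vector_derivative u' \<tau>) (at \<tau> within {s..t})"
          using der[OF loc(1)[OF \<tau>]] by (rule has_vector_derivative_within_subset) (use st in auto)
        moreover have "((\<lambda>\<tau>. (\<epsilon> * (t - \<tau>)) *\<^sub>R T) has_vector_derivative - (\<epsilon> *\<^sub>R T)) (at \<tau> within {s..t})"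
          by (auto intro!: derivative_eq_intros simp: has_vector_derivative_def algebra_simps)
        ultimately show ?thesis
          using has_vector_derivative_diff[of u "u' \<tau>" _ "\<lambda>\<tau>. (\<epsilon> * (t - \<tau>)) *\<^sub>R T"]
          unfolding w_def[abs_def] w'_def by fastforce
      qed
      show "continuous_on {s..t} w'"
        unfolding w'_def using loc(1) by (intro continuous_intros continuous_on_subset[OF u'cont]) auto
    qed
    moreover have "coord_inv c (w t) = \<gamma> t" using inv(1)[OF sN(2)] by (simp add: w_def)
    moreover have "coord_inv c (w s) \<in> W"
    proof -
      have "dist (u s) (w s) = \<epsilon> * L" using \<epsilon>(1) s_t by (simp add: w_def L_def dist_norm)
      then have "w s \<in> ball (u s) \<rho>" using \<epsilon>L(1) \<kappa>(3) by simp
      then have "w s \<in> snd c ` (fst c \<inter> W)" using \<rho>(2) by blast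
      then show ?thesis using c(1) by auto
    qed
    ultimately show ?thesis using up by simp
  qed (use st in simp)
  with d show ?thesis by blast
qed

text \<open>Passing from \<open>\<gamma> s \<in> W\<close> to \<open>\<gamma> t \<in> W\<close> is
  transitive in the parameter and holds on short intervals around every parameter, which is what the
  Bolzano principle needs.\<close>

lemma causal_push_up:
  assumes causal: "C1_path M (future_causal M) x y"
    and W: "openin X W" and up: "\<And>x y. x \<in> W \<Longrightarrow> C1_path M (future_timelike M) x y \<Longrightarrow> y \<in> W"
    and x: "x \<in> W"
  shows "y \<in> W"
proof -
  obtain \<gamma> a b where \<gamma>: "C1_curve M \<gamma> a b" "\<gamma> a = x" "\<gamma> b = y"
    "\<And>t. t \<in> {a..b} \<Longrightarrow> future_causal M (\<gamma> t) (velocity \<A> \<gamma> a b t)"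
    using causal unfolding C1_path_def by blast
  have "a \<le> b" using \<gamma>(1) by (simp add: C1_curve_def)
  then have "a \<le> a \<and> b \<le> b \<and> \<gamma> a \<in> W \<longrightarrow> \<gamma> b \<in> W"
  proof (induction rule: Bolzano[where P = "\<lambda>s t. a \<le> s \<and> t \<le> b \<and> \<gamma> s \<in> W \<longrightarrow> \<gamma> t \<in> W"])
    case (trans s t r)
    then show ?case by (meson order_trans)
  next
    case (local \<tau>0)
    then have "\<tau>0 \<in> {a..b}" by simp
    have "\<exists>d>0. \<forall>s t. a \<le> s \<and> s \<le> \<tau>0 \<and> \<tau>0 \<le> t \<and> t \<le> b \<and> t - s < d \<and> \<gamma> s \<in> W \<longrightarrow> \<gamma> t \<in> W"
      by (rule causal_push_up_local[OF \<gamma>(1) _ \<open>\<tau>0 \<in> {a..b}\<close> W]) (use \<gamma>(4) up in blast)+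
    then show ?case by blast
  qed
  then show ?thesis using x \<gamma>(2,3) by simp
qed

end

section \<open>Time reversal\<close>

text \<open>Only the orientation changes; topology, atlas and metric are literally the same, so open
  sets, curves and regularisation need no translation.\<close>

definition reverse :: "('a, 'e::euclidean_space) spacetime \<Rightarrow> ('a, 'e) spacetime" where
  "reverse M = M\<lparr>orient := \<lambda>p c. - orient M p c\<rparr>"

lemma reverse_simps [simp]:
  "pts (reverse M) = pts M" "atlas (reverse M) = atlas M" "metric (reverse M) = metric M"
  "orient (reverse M) p c = - orient M p c" "reverse (reverse M) = M"
  "metric_coord (reverse M) = metric_coord M" "C1_curve (reverse M) = C1_curve M"
  by (simp_all add: reverse_def metric_coord_def C1_curve_def fun_eq_iff)

context lorentz_spacetime
begin

lemma tangent_space_uminus: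
  assumes p: "p \<in> topspace X" and v: "v \<in> tangent_space \<A> p"
  shows "(\<lambda>c. - v c) \<in> tangent_space \<A> p"
proof -
  obtain c where c: "c \<in> \<A>" "p \<in> fst c" using chart_cover p by blast
  show ?thesis
    using coord_vec_in_tangent_space[OF c, of "- v c"] unfolding coord_vec_uminus[OF c]
    by (simp add: coord_vec_tangent[OF v c])
qed

lemma lorentz_spacetime_reverse: "lorentz_spacetime (reverse M)"
proof
  have "timelike_vector (reverse M) p (orient (reverse M) p)" if p: "p \<in> topspace X" for p
  proof -
    obtain c where c: "c \<in> \<A>" "p \<in> fst c" using chart_cover p by blast
    have v: "(\<lambda>c. - orient M p c) \<in> tangent_space \<A> p"
      using tangent_space_uminus[OF p orient_tangent[OF p]] .
    have "metric M p (\<lambda>c. - orient M p c) (\<lambda>c. - orient M p c) < 0"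
      using orient_timelike[OF c] bilinear_coord[OF c]
      by (simp add: metric_tangent[OF v v c] bilinear_lneg bilinear_rneg)
    moreover have "orient M p \<noteq> (\<lambda>_. 0)"
      using smooth_spacetime p
      by (simp add: smooth_spacetime_def time_orientation_def timelike_vector_def)
    then have "(\<lambda>c. - orient M p c) \<noteq> (\<lambda>_. 0)" unfolding fun_eq_iff by simp
    moreover have "orient (reverse M) p = (\<lambda>c. - orient M p c)" by (rule ext) simp
    ultimately show ?thesis using v by (simp add: timelike_vector_def)
  qed
  then have "time_orientation (reverse M)"
    using smooth_spacetime
    by (simp add: smooth_spacetime_def time_orientation_def continuous_map_minus)
  then show "smooth_spacetime (reverse M)"
    using smooth_spacetime by (simp add: smooth_spacetime_def lorentzian_metric_def)
qed

lemma future_timelike_reverse: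
  assumes p: "p \<in> topspace X" and v: "future_timelike M p v"
  shows "future_timelike (reverse M) p (\<lambda>c. - v c)"
proof -
  obtain c where c: "c \<in> \<A>" "p \<in> fst c" using chart_cover p by blast
  have t: "v \<in> tangent_space \<A> p"
    using v future_timelike_imp_causal future_causal_tangent by blast
  have "future_timelike (reverse M) p (\<lambda>c. - v c) \<longleftrightarrow>
      metric_coord M c p (- v c) (- v c) < 0 \<and> metric_coord M c p (- v c) (- orient M p c) < 0"
    using lorentz_spacetime.future_timelike_coord[OF lorentz_spacetime_reverse, unfolded reverse_simps,
        OF tangent_space_uminus[OF p t] c] .
  then show ?thesis
    using future_timelike_coord[OF t c] v bilinear_coord[OF c] by (simp add: bilinear_lneg bilinear_rneg)
qed

lemma future_causal_reverse:
  assumes p: "p \<in> topspace X" and v: "future_causal M p v"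
  shows "future_causal (reverse M) p (\<lambda>c. - v c)"
proof -
  obtain c where c: "c \<in> \<A>" "p \<in> fst c" using chart_cover p by blast
  have t: "v \<in> tangent_space \<A> p" using v future_causal_tangent by blast
  have "future_causal (reverse M) p (\<lambda>c. - v c) \<longleftrightarrow>
      metric_coord M c p (- v c) (- v c) \<le> 0 \<and> metric_coord M c p (- v c) (- orient M p c) < 0"
    using lorentz_spacetime.future_causal_coord[OF lorentz_spacetime_reverse, unfolded reverse_simps,
        OF tangent_space_uminus[OF p t] c] .
  then show ?thesis
    using future_causal_coord[OF t c] v bilinear_coord[OF c] by (simp add: bilinear_lneg bilinear_rneg)
qed

end

lemma C1_path_reverse:
  assumes Q: "\<And>p v. p \<in> topspace (pts M) \<Longrightarrow> Q p v \<Longrightarrow> Q' p (\<lambda>c. - v c)" and "C1_path M Q x y"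
  shows "C1_path (reverse M) Q' y x"
proof -
  obtain \<gamma> a b where \<gamma>: "C1_curve M \<gamma> a b" "\<forall>t\<in>{a..b}. Q (\<gamma> t) (velocity (atlas M) \<gamma> a b t)"
    "\<gamma> a = x" "\<gamma> b = y"
    using assms(2) unfolding C1_path_def by blast
  have ab: "- b < - a" and cont: "continuous_map (top_of_set {a..b}) (pts M) \<gamma>"
    using \<gamma>(1) unfolding C1_curve_def by auto
  let ?\<delta> = "\<lambda>t. \<gamma> (- t)"
  note aff = C1_curve_affine[of M \<gamma> a b "- b" "- a" "- 1" 0 ?\<delta>, OF \<gamma>(1) ab]
  have "Q' (?\<delta> t) (velocity (atlas M) ?\<delta> (- b) (- a) t)" if t: "t \<in> {- b..- a}" for t
  proof -
    have t': "- t \<in> {a..b}" using t by auto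
    then have "\<gamma> (- t) \<in> topspace (pts M)"
      using continuous_map_image_subset_topspace[OF cont] by auto
    from Q[OF this] \<gamma>(2) t' have "Q' (\<gamma> (- t)) (\<lambda>c. - velocity (atlas M) \<gamma> a b (- t) c)" by blast
    moreover have "velocity (atlas M) ?\<delta> (- b) (- a) t = (\<lambda>c. - velocity (atlas M) \<gamma> a b (- t) c)"
      using aff(2)[of t] t by auto
    ultimately show ?thesis by simp
  qed
  moreover have "C1_curve M ?\<delta> (- b) (- a)" using aff(1) by auto
  ultimately show ?thesis
    unfolding C1_path_def using \<gamma>(3,4)
    by (intro exI[of _ ?\<delta>] exI[of _ "- b"] exI[of _ "- a"]) simp
qed

context lorentz_spacetime
begin

text \<open>One inclusion is path reversal in \<open>M\<close>, the other is path reversal in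
  \<open>reverse M\<close>, since reversing twice gives back \<open>M\<close>.\<close>

lemma C1_path_timelike_reverse:
  "C1_path (reverse M) (future_timelike (reverse M)) = (C1_path M (future_timelike M))\<inverse>\<inverse>"
proof (intro ext iffI)
  interpret rev: lorentz_spacetime "reverse M" by (rule lorentz_spacetime_reverse)
  fix x y
  show "(C1_path M (future_timelike M))\<inverse>\<inverse> x y" if "C1_path (reverse M) (future_timelike (reverse M)) x y"
    using C1_path_reverse[OF _ that, of "future_timelike M"] rev.future_timelike_reverse by auto
  show "C1_path (reverse M) (future_timelike (reverse M)) x y" if "(C1_path M (future_timelike M))\<inverse>\<inverse> x y"
    using C1_path_reverse[of M "future_timelike M" "future_timelike (reverse M)" y x]
      future_timelike_reverse that by simp
qed

lemma C1_path_causal_reverse: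
  "C1_path (reverse M) (future_causal (reverse M)) = (C1_path M (future_causal M))\<inverse>\<inverse>"
proof (intro ext iffI)
  interpret rev: lorentz_spacetime "reverse M" by (rule lorentz_spacetime_reverse)
  fix x y
  show "(C1_path M (future_causal M))\<inverse>\<inverse> x y" if "C1_path (reverse M) (future_causal (reverse M)) x y"
    using C1_path_reverse[OF _ that, of "future_causal M"] rev.future_causal_reverse by auto
  show "C1_path (reverse M) (future_causal (reverse M)) x y" if "(C1_path M (future_causal M))\<inverse>\<inverse> x y"
    using C1_path_reverse[of M "future_causal M" "future_causal (reverse M)" y x]
      future_causal_reverse that by simp
qed

lemma chron_less_reverse: "chron_less (reverse M) x y \<longleftrightarrow> chron_less M y x"
  by (simp add: chron_less_iff_tranclp C1_path_timelike_reverse tranclp_converse)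

lemma causal_le_reverse: "causal_le (reverse M) x y \<longleftrightarrow> causal_le M y x"
  by (auto simp: causal_le_iff_tranclp C1_path_causal_reverse tranclp_converse)

lemma I_J_reverse:
  "I_plus (reverse M) = I_minus M" "I_minus (reverse M) = I_plus M"
  "J_plus (reverse M) = J_minus M" "J_minus (reverse M) = J_plus M"
  by (simp_all add: fun_eq_iff I_plus_def I_minus_def J_plus_def J_minus_def
      chron_less_reverse causal_le_reverse)

section \<open>The chronology relation\<close>

lemma chron_less_trans: "chron_less M x y \<Longrightarrow> chron_less M y z \<Longrightarrow> chron_less M x z"
  unfolding chron_less_iff_tranclp by (rule tranclp_trans)

lemma chron_less_last_step:
  assumes "chron_less M x y"
  obtains z where "x = z \<or> chron_less M x z" "C1_path M (future_timelike M) z y"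
  using assms unfolding chron_less_iff_tranclp by (auto elim: tranclp.cases)

lemma chron_less_step: "C1_path M (future_timelike M) x y \<Longrightarrow> chron_less M x y"
  unfolding chron_less_iff_tranclp by (rule tranclp.r_into_trancl)

lemma chron_less_step_trans:
  "x = z \<or> chron_less M x z \<Longrightarrow> C1_path M (future_timelike M) z y \<Longrightarrow> chron_less M x y"
  using chron_less_trans chron_less_step by blast

lemma chron_less_dense: "chron_less M x y \<Longrightarrow> \<exists>z. chron_less M x z \<and> chron_less M z y"
  using C1_path_dense chron_less_last_step chron_less_step chron_less_step_trans by metis

text \<open>Only the last segment of the chain is varied: \<open>C1_path_open\<close> gives a point
  on it from which a whole neighbourhood of its end can be reached.\<close>

lemma openin_future: "openin X {y. chron_less M x y}"
proof (subst openin_subopen, intro ballI)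
  fix y assume "y \<in> {y. chron_less M x y}"
  then obtain z where z: "x = z \<or> chron_less M x z" "C1_path M (future_timelike M) z y"
    using chron_less_last_step by blast
  obtain p U where p: "C1_path M (future_timelike M) z p" and U: "openin X U" "y \<in> U"
    "\<And>q. q \<in> U \<Longrightarrow> C1_path M (future_timelike M) p q"
    using C1_path_open[OF z(2)] by blast
  have "chron_less M x q" if "q \<in> U" for q
    using chron_less_step_trans[OF z(1) p] U(3)[OF that] chron_less_step_trans by blast
  then show "\<exists>T. openin X T \<and> y \<in> T \<and> T \<subseteq> {y. chron_less M x y}"
    using U(1,2) by blast
qed

lemma openin_past: "openin X {x. chron_less M x y}"
  using lorentz_spacetime.openin_future[OF lorentz_spacetime_reverse, of y]
  by (simp add: chron_less_reverse)

lemma openin_I: "openin X (I_plus M A)" "openin X (I_minus M A)"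
proof -
  have "I_plus M A = (\<Union>x\<in>A. {y. chron_less M x y})" "I_minus M A = (\<Union>y\<in>A. {x. chron_less M x y})"
    by (auto simp: I_plus_def I_minus_def)
  then show "openin X (I_plus M A)" "openin X (I_minus M A)"
    using openin_future openin_past by auto
qed

text \<open>Every point has some timelike successor; the reversed path from it ends at
  \<open>u\<close>, so it enters \<open>U\<close> before its end, at a point later than
  \<open>u\<close>.\<close>

lemma open_subset_I_minus:
  assumes U: "openin X U"
  shows "U \<subseteq> I_minus M U"
proof -
  interpret rev: lorentz_spacetime "reverse M" by (rule lorentz_spacetime_reverse)
  have "\<exists>v\<in>U. chron_less M u v" if u: "u \<in> U" for u
  proof -
    have "u \<in> topspace (pts M)" using u U openin_subset by blast
    then obtain q where "C1_path M (future_timelike M) u q" using chronological_future_nonempty by blast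
    then have "C1_path (reverse M) (future_timelike (reverse M)) q u" by (simp add: C1_path_timelike_reverse)
    then obtain z where z: "z \<in> U" "C1_path (reverse M) (future_timelike (reverse M)) z u"
      using C1_path_meets_open[of "reverse M" "future_timelike (reverse M)" q u U] U u by auto
    from rev.chron_less_step[OF z(2)] z(1) show ?thesis unfolding chron_less_reverse by blast
  qed
  then show ?thesis by (auto simp: I_minus_def)
qed

lemma open_subset_I_plus: "openin X U \<Longrightarrow> U \<subseteq> I_plus M U"
  using lorentz_spacetime.open_subset_I_minus[OF lorentz_spacetime_reverse] by (simp add: I_J_reverse)

text \<open>\<open>causal_push_up\<close> with \<open>W = I_plus M U\<close>, once for each segment;
  the start is in \<open>W\<close> because \<open>U\<close> lies in its own future.\<close>

lemma J_plus_open: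
  assumes U: "openin X U"
  shows "J_plus M U \<subseteq> I_plus M U"
proof
  fix y assume "y \<in> J_plus M U"
  then obtain x where x: "x \<in> U" "causal_le M x y" by (auto simp: J_plus_def)
  then have x': "x \<in> I_plus M U" using open_subset_I_plus[OF U] by blast
  have up: "q \<in> I_plus M U" if "p \<in> I_plus M U" "C1_path M (future_timelike M) p q" for p q
    using that chron_less_step_trans unfolding I_plus_def by blast
  from x(2) have "x = y \<or> (C1_path M (future_causal M))\<^sup>+\<^sup>+ x y"
    unfolding causal_le_iff_tranclp by blast
  then show "y \<in> I_plus M U"
  proof
    assume "(C1_path M (future_causal M))\<^sup>+\<^sup>+ x y"
    then show ?thesis
    proof (induction rule: tranclp_induct)
      case (base y)
      show ?case by (rule causal_push_up[OF base openin_I(1) up x'])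
    next
      case (step y z)
      show ?case by (rule causal_push_up[OF step(2) openin_I(1) up step(3)])
    qed
  qed (use x' in simp)
qed

lemma J_minus_open: "openin X U \<Longrightarrow> J_minus M U \<subseteq> I_minus M U"
  using lorentz_spacetime.J_plus_open[OF lorentz_spacetime_reverse] by (simp add: I_J_reverse)

lemma I_subset_J: "I_plus M A \<subseteq> J_plus M A" "I_minus M A \<subseteq> J_minus M A"
proof -
  have "causal_le M x y" if "chron_less M x y" for x y
  proof -
    have mono: "C1_path M (future_causal M) p q" if "C1_path M (future_timelike M) p q" for p q
      by (rule C1_path_mono[OF _ that]) (rule future_timelike_imp_causal)
    from that have "(C1_path M (future_causal M))\<^sup>+\<^sup>+ x y"
      unfolding chron_less_iff_tranclp
    proof (induction rule: tranclp_induct)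
      case (base y)
      from mono[OF base] show ?case by (rule tranclp.r_into_trancl)
    next
      case (step y z)
      from step(3) mono[OF step(2)] show ?case by (rule tranclp.trancl_into_trancl)
    qed
    then show ?thesis unfolding causal_le_iff_tranclp by blast
  qed
  then show "I_plus M A \<subseteq> J_plus M A" "I_minus M A \<subseteq> J_minus M A"
    unfolding I_plus_def I_minus_def J_plus_def J_minus_def by blast+
qed

lemma I_minus_idem: "I_minus M (I_minus M A) = I_minus M A"
  unfolding I_minus_def using chron_less_trans chron_less_dense by blast

lemma I_minus_mono: "A \<subseteq> B \<Longrightarrow> I_minus M A \<subseteq> I_minus M B"
  unfolding I_minus_def by blast

lemma I_minus_Un: "I_minus M (A \<union> B) = I_minus M A \<union> I_minus M B"
  unfolding I_minus_def by blast

lemma I_minus_negneg: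
  assumes U: "openin X U"
  shows "I_minus M (negneg X U) = I_minus M U"
proof
  show "I_minus M U \<subseteq> I_minus M (negneg X U)" by (rule I_minus_mono[OF negneg_le[OF U]])
  show "I_minus M (negneg X U) \<subseteq> I_minus M U"
  proof
    fix x assume "x \<in> I_minus M (negneg X U)"
    then obtain y where y: "chron_less M x y" "y \<in> negneg X U" by (auto simp: I_minus_def)
    from y(2) have "y \<in> X closure_of U" unfolding negneg_def by (rule subsetD[OF interior_of_subset])
    \<comment> \<open>The future of \<open>x\<close> is an open neighbourhood of \<open>y\<close>,
      and \<open>y\<close> is in the closure of \<open>U\<close>.\<close>
    then obtain z where "z \<in> U" "chron_less M x z"
      using openin_future[of x] y(1) unfolding in_closure_of by blast
    then show "x \<in> I_minus M U" by (auto simp: I_minus_def)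
  qed
qed

lemma I_plus_negneg: "openin X U \<Longrightarrow> I_plus M (negneg X U) = I_plus M U"
  using lorentz_spacetime.I_minus_negneg[OF lorentz_spacetime_reverse] by (simp add: I_J_reverse)

end

section \<open>The double-negation sublocale\<close>

lemma negneg_mono: "A \<subseteq> B \<Longrightarrow> negneg X A \<subseteq> negneg X B"
  unfolding negneg_def by (intro interior_of_mono closure_of_mono)

lemma openin_negneg: "openin X (negneg X A)"
  by (simp add: negneg_def)

lemma carrier_spacetime_dneg:
  "carrier (spacetime_dneg M) = {U. openin (pts M) U \<and> U = negneg (pts M) U}"
  by (simp add: spacetime_dneg_def dneg_olocale_def spacetime_olocale_def)

lemma negneg_in_carrier: "negneg (pts M) A \<in> carrier (spacetime_dneg M)"
  by (simp add: carrier_spacetime_dneg openin_negneg negneg_idem)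

lemma spacetime_dneg_binary_join:
  assumes "U \<in> carrier (spacetime_dneg M)" "V \<in> carrier (spacetime_dneg M)"
  shows "U \<squnion>\<^bsub>spacetime_dneg M\<^esub> V = negneg (pts M) (U \<union> V)"
  using spacetime_dneg_join[of "{U, V}" M] assms by (simp add: join_def)

lemma spacetime_dneg_bottom: "\<bottom>\<^bsub>spacetime_dneg M\<^esub> = {}"
proof -
  have le: "le (spacetime_dneg M) = (\<subseteq>)" by (simp add: spacetime_dneg_def dneg_olocale_def)
  have "{} \<in> carrier (spacetime_dneg M)" by (simp add: carrier_spacetime_dneg negneg_def)
  then have "least (spacetime_dneg M) x (carrier (spacetime_dneg M)) \<longleftrightarrow> x = {}" for x
    unfolding least_def le carrier_spacetime_dneg by blast
  then show ?thesis unfolding bottom_def by simp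
qed

text \<open>Joins of cones are computed with this: inner regularisations are absorbed by the outer
  one.\<close>

lemma negneg_Un_negneg:
  assumes "openin X A" "openin X B"
  shows "negneg X (negneg X A \<union> negneg X B) = negneg X (A \<union> B)"
proof
  have "negneg X A \<union> negneg X B \<subseteq> negneg X (A \<union> B)" by (simp add: negneg_mono)
  from negneg_mono[OF this, of X] show "negneg X (negneg X A \<union> negneg X B) \<subseteq> negneg X (A \<union> B)"
    by (simp add: negneg_idem)
  show "negneg X (A \<union> B) \<subseteq> negneg X (negneg X A \<union> negneg X B)"
    using negneg_le assms by (intro negneg_mono Un_mono)
qed

context lorentz_spacetime
begin

section \<open>The induced preorder, its down cones and the bijection\<close>

lemma trile_spacetime_dneg:
  assumes U: "openin X U" and V: "openin X V"
  shows "trile (spacetime_dneg M) U V \<longleftrightarrow> U \<subseteq> negneg X (I_minus M V) \<and> V \<subseteq> negneg X (I_plus M U)"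
proof -
  let ?r = "\<lambda>U V. U \<subseteq> J_minus M V \<and> V \<subseteq> J_plus M U"
  have def: "trile (spacetime_dneg M) U V \<longleftrightarrow>
     (\<forall>W. openin X W \<longrightarrow> U \<subseteq> negneg X W \<longrightarrow> (\<exists>W'. openin X W' \<and> ?r W W' \<and> V \<subseteq> negneg X W')) \<and>
     (\<forall>W'. openin X W' \<longrightarrow> V \<subseteq> negneg X W' \<longrightarrow> (\<exists>W. openin X W \<and> ?r W W' \<and> U \<subseteq> negneg X W))"
    by (simp add: spacetime_dneg_def dneg_olocale_def spacetime_olocale_def Bex_def conj_ac)
  \<comment> \<open>The future and the past of \<open>W\<close> are open sets related to
    \<open>W\<close>, and they serve as witnesses in the converse direction.\<close>
  have up: "?r W (I_plus M W)" and down: "?r (I_minus M W) W" if W: "openin X W" for W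
  proof -
    have "W \<subseteq> I_minus M (I_plus M W)"
      using open_subset_I_minus[OF W] open_subset_I_plus[OF W] I_minus_mono by blast
    moreover have "W \<subseteq> I_plus M (I_minus M W)"
      using open_subset_I_minus[OF W] open_subset_I_plus[OF W] unfolding I_plus_def by blast
    ultimately show "?r W (I_plus M W)" "?r (I_minus M W) W" using I_subset_J by blast+
  qed
  show ?thesis unfolding def
  proof (intro iffI conjI allI impI)
    assume L: "(\<forall>W. openin X W \<longrightarrow> U \<subseteq> negneg X W \<longrightarrow> (\<exists>W'. openin X W' \<and> ?r W W' \<and> V \<subseteq> negneg X W')) \<and>
      (\<forall>W'. openin X W' \<longrightarrow> V \<subseteq> negneg X W' \<longrightarrow> (\<exists>W. openin X W \<and> ?r W W' \<and> U \<subseteq> negneg X W))"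
    \<comment> \<open>The defining condition is tested on \<open>U\<close> itself, and below on
      \<open>V\<close>.\<close>
    obtain W' where W': "?r U W'" "V \<subseteq> negneg X W'"
      using conjunct1[OF L, rule_format, OF U negneg_le[OF U]] by blast
    then have "W' \<subseteq> I_plus M U" using J_plus_open[OF U] by blast
    from W'(2) negneg_mono[OF this] show "V \<subseteq> negneg X (I_plus M U)" by (rule subset_trans)
    obtain W where W: "?r W V" "U \<subseteq> negneg X W"
      using conjunct2[OF L, rule_format, OF V negneg_le[OF V]] by blast
    then have "W \<subseteq> I_minus M V" using J_minus_open[OF V] by blast
    from W(2) negneg_mono[OF this] show "U \<subseteq> negneg X (I_minus M V)" by (rule subset_trans)
  next
    assume R: "U \<subseteq> negneg X (I_minus M V) \<and> V \<subseteq> negneg X (I_plus M U)"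
    fix W assume W: "openin X W"
    show "\<exists>W'. openin X W' \<and> ?r W W' \<and> V \<subseteq> negneg X W'" if UW: "U \<subseteq> negneg X W"
    proof -
      \<comment> \<open>Taking futures removes the regularisation of \<open>W\<close>, so the
        witness \<open>I_plus M W\<close> depends on \<open>W\<close> alone.\<close>
      have "I_plus M U \<subseteq> I_plus M (negneg X W)" using UW unfolding I_plus_def by blast
      then have "negneg X (I_plus M U) \<subseteq> negneg X (I_plus M W)"
        unfolding I_plus_negneg[OF W] by (rule negneg_mono)
      then show ?thesis using R up[OF W] openin_I(1)[of W] by blast
    qed
    show "\<exists>W'. openin X W' \<and> ?r W' W \<and> U \<subseteq> negneg X W'" if VW: "V \<subseteq> negneg X W"
    proof -
      have "negneg X (I_minus M V) \<subseteq> negneg X (I_minus M W)"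
        using I_minus_mono[OF VW] unfolding I_minus_negneg[OF W] by (rule negneg_mono)
      then show ?thesis using R down[OF W] openin_I(2)[of W] by blast
    qed
  qed
qed

text \<open>The join is attained: \<open>?N\<close> is itself related to \<open>U\<close>, and
  contains every other member of the family.\<close>

lemma down_cone_spacetime_dneg:
  assumes U: "openin X U"
  shows "down_cone (spacetime_dneg M) U = negneg X (I_minus M U)"
proof -
  let ?L = "spacetime_dneg M" and ?N = "negneg X (I_minus M U)"
  let ?S = "{W \<in> carrier ?L. trile ?L W U}"
  have S: "W \<subseteq> ?N" if "W \<in> ?S" for W
  proof -
    have "openin X W" "trile ?L W U" using that unfolding carrier_spacetime_dneg by blast+
    then show ?thesis using trile_spacetime_dneg[OF _ U] by blast
  qed
  have "U \<subseteq> I_plus M (I_minus M U)"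
    using open_subset_I_minus[OF U] open_subset_I_plus[OF U] unfolding I_plus_def by blast
  also have "\<dots> \<subseteq> negneg X (I_plus M ?N)"
    unfolding I_plus_negneg[OF openin_I(2)] by (rule negneg_le[OF openin_I(1)])
  finally have "?N \<in> ?S"
    using trile_spacetime_dneg[OF openin_negneg U] negneg_in_carrier by blast
  then have "\<Union>?S = ?N" using S by blast
  then show ?thesis
    unfolding down_cone_def using spacetime_dneg_join[of ?S M] by (simp add: negneg_idem)
qed

lemma bij_betw_IP: "bij_betw (negneg X) (spacetime_IP M) (locale_IP (spacetime_dneg M))"
proof (rule bij_betw_byWitness[where f' = "I_minus M"])
  let ?L = "spacetime_dneg M"
  have IP: "P = I_minus M P" "openin X P" "P \<noteq> {}" if "P \<in> spacetime_IP M" for P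
  proof -
    show P: "P = I_minus M P" and "P \<noteq> {}" using that unfolding spacetime_IP_def by blast+
    show "openin X P" by (subst P) (rule openin_I)
  qed
  have lIP: "negneg X (I_minus M Q) = Q" "openin X Q" if "Q \<in> locale_IP ?L" for Q
  proof -
    show "openin X Q" using that by (simp add: locale_IP_def carrier_spacetime_dneg)
    then show "negneg X (I_minus M Q) = Q"
      using that down_cone_spacetime_dneg by (simp add: locale_IP_def)
  qed
  show "\<forall>P\<in>spacetime_IP M. I_minus M (negneg X P) = P" using IP I_minus_negneg by metis
  show "\<forall>Q\<in>locale_IP ?L. negneg X (I_minus M Q) = Q" using lIP by blast
  show "negneg X ` spacetime_IP M \<subseteq> locale_IP ?L"
  proof (rule image_subsetI)
    fix P assume P: "P \<in> spacetime_IP M"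
    have ip: "I_minus M (negneg X P) = P" using IP[OF P] I_minus_negneg by metis
    have "negneg X P = down_cone ?L U \<or> negneg X P = down_cone ?L V"
      if UV: "U \<in> carrier ?L" "V \<in> carrier ?L" and eq: "negneg X P = down_cone ?L U \<squnion>\<^bsub>?L\<^esub> down_cone ?L V" for U V
    proof -
      have o: "openin X U" "openin X V" using UV by (simp_all add: carrier_spacetime_dneg)
      have sub: "U \<subseteq> topspace X" "V \<subseteq> topspace X" using o openin_subset by blast+
      \<comment> \<open>Applying \<open>I_minus\<close> below strips all regularisations and turns a
        join of cones into a union of pasts.\<close>
      have "negneg X P = negneg X (I_minus M U \<union> I_minus M V)"
        using eq by (simp add: down_cone_spacetime_dneg o spacetime_dneg_binary_join negneg_in_carrier
            negneg_Un_negneg openin_I)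
      then have "P = I_minus M (negneg X (I_minus M U \<union> I_minus M V))" using ip by simp
      also have "\<dots> = I_minus M U \<union> I_minus M V"
        by (simp add: I_minus_negneg openin_I openin_Un I_minus_Un I_minus_idem)
      finally have "P = I_minus M U \<or> P = I_minus M V"
        using P sub unfolding spacetime_IP_def by blast
      then show ?thesis using down_cone_spacetime_dneg o by metis
    qed
    moreover have "negneg X P \<noteq> {}" using IP[OF P] negneg_le by blast
    moreover have "negneg X P = down_cone ?L (negneg X P)"
      by (simp add: down_cone_spacetime_dneg openin_negneg ip)
    ultimately show "negneg X P \<in> locale_IP ?L"
      unfolding locale_IP_def spacetime_dneg_bottom using negneg_in_carrier by blast
  qed
  show "I_minus M ` locale_IP ?L \<subseteq> spacetime_IP M"
  proof (rule image_subsetI)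
    fix Q assume Q: "Q \<in> locale_IP ?L"
    have "I_minus M Q = I_minus M A \<or> I_minus M Q = I_minus M B"
      if eq: "I_minus M Q = I_minus M A \<union> I_minus M B" for A B
    proof -
      \<comment> \<open>\<open>A\<close> and \<open>B\<close> are arbitrary sets of points; the
        regularisations of their pasts are regular opens that equal their own down cones, so they
        fit the primeness condition on \<open>Q\<close>.\<close>
      let ?U = "negneg X (I_minus M A)" and ?V = "negneg X (I_minus M B)"
      have cone: "down_cone ?L (negneg X (I_minus M C)) = negneg X (I_minus M C)" for C
        by (simp add: down_cone_spacetime_dneg openin_negneg I_minus_negneg openin_I I_minus_idem)
      have "Q = negneg X (I_minus M A \<union> I_minus M B)" using lIP(1)[OF Q] eq by simp
      also have "\<dots> = down_cone ?L ?U \<squnion>\<^bsub>?L\<^esub> down_cone ?L ?V"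
        by (simp add: cone spacetime_dneg_binary_join negneg_in_carrier negneg_Un_negneg openin_I)
      finally have eq': "Q = down_cone ?L ?U \<squnion>\<^bsub>?L\<^esub> down_cone ?L ?V" .
      have "\<forall>U\<in>carrier ?L. \<forall>V\<in>carrier ?L. Q = down_cone ?L U \<squnion>\<^bsub>?L\<^esub> down_cone ?L V \<longrightarrow>
          Q = down_cone ?L U \<or> Q = down_cone ?L V"
        using Q unfolding locale_IP_def by blast
      from this[rule_format, OF negneg_in_carrier negneg_in_carrier eq']
      have "Q = ?U \<or> Q = ?V" unfolding cone .
      moreover have "I_minus M (negneg X (I_minus M C)) = I_minus M C" for C
        by (simp add: I_minus_negneg openin_I I_minus_idem)
      ultimately show ?thesis by metis
    qed
    moreover have "I_minus M Q \<noteq> {}"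
    proof
      assume "I_minus M Q = {}"
      then have "Q = {}" using open_subset_I_minus[OF lIP(2)[OF Q]] by simp
      then show False using Q by (simp add: locale_IP_def spacetime_dneg_bottom)
    qed
    moreover have "I_minus M Q \<subseteq> topspace X" using openin_I(2) openin_subset by blast
    ultimately show "I_minus M Q \<in> spacetime_IP M"
      unfolding spacetime_IP_def using I_minus_idem by blast
  qed
qed

lemma spacetime_IP_reverse: "spacetime_IP (reverse M) = spacetime_IF M"
  by (simp add: spacetime_IP_def spacetime_IF_def I_J_reverse)

text \<open>The symmetric form of \<open>trile_spacetime_dneg\<close> shows that reversal flips the
  preorder on the carrier, hence exchanges the cones. Joins agree, since they depend only on the
  topology.\<close>

lemma locale_IP_reverse: "locale_IP (spacetime_dneg (reverse M)) = locale_IF (spacetime_dneg M)"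
proof -
  let ?L = "spacetime_dneg M" and ?R = "spacetime_dneg (reverse M)"
  have car: "carrier ?R = carrier ?L" by (simp add: carrier_spacetime_dneg)
  have trile: "trile ?R U V \<longleftrightarrow> trile ?L V U" if "U \<in> carrier ?L" "V \<in> carrier ?L" for U V
    using that trile_spacetime_dneg[of V U]
      lorentz_spacetime.trile_spacetime_dneg[OF lorentz_spacetime_reverse, of U V]
    by (auto simp: carrier_spacetime_dneg I_J_reverse)
  have cone: "down_cone ?R U = up_cone ?L U" if "U \<in> carrier ?L" for U
  proof -
    have "{W \<in> carrier ?R. trile ?R W U} = {W \<in> carrier ?L. trile ?L U W}"
      using trile that car by blast
    then show ?thesis
      using spacetime_dneg_join[of "{W \<in> carrier ?L. trile ?L U W}" M]
        spacetime_dneg_join[of "{W \<in> carrier ?L. trile ?L U W}" "reverse M"]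
      by (simp add: down_cone_def up_cone_def car)
  qed
  have up: "up_cone ?L U \<in> carrier ?L" for U
    using spacetime_dneg_join[of "{W \<in> carrier ?L. trile ?L U W}" M] negneg_in_carrier
    by (simp add: up_cone_def)
  have join: "U \<squnion>\<^bsub>?R\<^esub> V = U \<squnion>\<^bsub>?L\<^esub> V" if "U \<in> carrier ?L" "V \<in> carrier ?L" for U V
    using that spacetime_dneg_binary_join[of U M V] spacetime_dneg_binary_join[of U "reverse M" V] car
    by simp
  show ?thesis
    unfolding locale_IP_def locale_IF_def car spacetime_dneg_bottom
    by (intro Collect_cong conj_cong refl ball_cong) (simp_all add: cone join up)
qed

end

theorem corollary7p53:
  fixes M :: "('a, 'e::euclidean_space) spacetime"
  assumes "smooth_spacetime M"
  shows "(\<exists>f. bij_betw f (spacetime_IP M) (locale_IP (spacetime_dneg M))) \<and>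
         (\<exists>f. bij_betw f (spacetime_IF M) (locale_IF (spacetime_dneg M)))"
proof -
  interpret lorentz_spacetime M using assms by unfold_locales
  have "bij_betw (negneg X) (spacetime_IF M) (locale_IF (spacetime_dneg M))"
    using lorentz_spacetime.bij_betw_IP[OF lorentz_spacetime_reverse]
    by (simp add: spacetime_IP_reverse locale_IP_reverse)
  then show ?thesis using bij_betw_IP by blast
qed

end
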